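(* Let $F \subset G$ be any finite generating set of $G$. Then for all large enough $n$, the set $\{f_n \mid f \in F\}$ generates $G_n = \mathrm{Alt}(\{0,1\}^n)$.
   Context: Let $X = \{0,1\}^{\mathbb{Z}}$ with the product topology. The shift $\sigma : X \to X$ is $\sigma(x)_i = x_{i+1}$. A homeomorphism $f : X \to X$ is called inert if there exists $r$ such that $f(x)_i = x_i$ for all $x \in X$ and all $|i| \geq r$. The group $G$ is the subgroup of the self-homeomorphism group of $X$ generated by $\sigma$ and all inert homeomorphisms. Every $f \in G$ can be written uniquely as $f = \sigma^m \circ g$ with $m \in \mathbb{Z}$ and $g$ inert; $g$ is the inert part of $f$. For an inert $g$, a strong radius is a number $R \in \mathbb{N}$ (with $0 \in \mathbb{N}$) for which there is a map $\hat g : \{0,1\}^{[-R,R]} \to \{0,1\}^{[-R,R]}$ such that for all $x \in X$, $g(x)_i = x_i$ for $|i| > R$ and $g(x)_i = \hat g(x_{[-R,R]})_i$ for $i \in [-R,R]$ (every inert $g$ has one). The strong shift-invariant radius of an inert $g$ is the minimal $R$ among all strong radii of all conjugates $\sigma^{m} \circ g \circ \sigma^{-m}$, $m \in \mathbb{Z}$. For $n \geq 1$ let $X_n = \{x \in X \mid \sigma^n(x) = x\}$. Let $f = \sigma^m \circ g \in G$ with $g$ inert of strong shift-invariant radius $R$, and let $n > 2R+1$. For $x \in X_n$ define $$\bar f_n(x) = \sigma^m\Big( \lim_{k \to \infty} \Big(\prod_{i=-k}^k \sigma^{-in} \circ g \circ \sigma^{in}\Big)(x)\Big),$$ where the product is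 composition (the factors commute pairwise and the limit exists). For $w \in \{0,1\}^n$ (indexed by $0,\dots,n-1$) define $f_n(w) = \bar f_n(x)_{[0,n-1]}$ where $x = \dots www.www \dots \in X_n$ is the $n$-periodic point with $x_{[0,n-1]} = w$. For example, $\sigma_n(aw) = wa$ for $a \in \{0,1\}$, $w \in \{0,1\}^{n-1}$. For finite $F \subset G$, all $f_n$ with $f \in F$ are defined when $n$ is large enough. $\mathrm{Alt}(\{0,1\}^n)$ is the alternating group on the set of $2^n$ binary words of length $n$. *)

theory Defs
  imports "HOL-Analysis.Function_Topology" "HOL-Algebra.Sym_Groups"
begin

text \<open>
  Bi-infinite binary sequences are functions of type \<^typ>\<open>int \<Rightarrow> bool\<close>. The type class topology
  on them is the product topology of the discrete topology on \<^typ>\<open>bool\<close>. The constant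
  \<^const>\<open>lim\<close> needs it to be Hausdorff.
\<close>

instance "fun" :: (type, t2_space) t2_space
proof
  fix f g :: "'a \<Rightarrow> 'b"
  assume "f \<noteq> g"
  then obtain i where "f i \<noteq> g i" by auto
  then obtain U V where UV: "open U" "open V" "f i \<in> U" "g i \<in> V" "U \<inter> V = {}"
    using hausdorff[of "f i" "g i"] by auto
  have *: "open ((\<lambda>h. h i) -` W)" if "open W" for W :: "'b set"
    using that by (rule open_vimage) (rule continuous_on_product_coordinates)
  show "\<exists>U V. open U \<and> open V \<and> f \<in> U \<and> g \<in> V \<and> U \<inter> V = {}"
  proof (intro exI conjI)
    show "open ((\<lambda>h. h i) -` U)" "open ((\<lambda>h. h i) -` V)"
      using *[OF UV(1)] *[OF UV(2)] .
  qed (use UV(3-5) in auto)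
qed

type_synonym point = "int \<Rightarrow> bool"

definition homeo_group :: "(point \<Rightarrow> point) monoid" where
  "homeo_group = \<lparr>carrier = {f. \<exists>f'. homeomorphism UNIV UNIV f f'}, mult = (\<circ>), one = id\<rparr>"

definition shift :: "point \<Rightarrow> point" where
  "shift x = (\<lambda>i. x (i + 1))"

abbreviation shift_pow :: "int \<Rightarrow> point \<Rightarrow> point" where
  "shift_pow m \<equiv> shift [^]\<^bsub>homeo_group\<^esub> m"

definition inert :: "(point \<Rightarrow> point) \<Rightarrow> bool" where
  "inert f \<longleftrightarrow> f \<in> carrier homeo_group \<and> (\<exists>r. \<forall>x i. \<bar>i\<bar> \<ge> r \<longrightarrow> f x i = x i)"

definition shift_inert_group :: "(point \<Rightarrow> point) set" where
  "shift_inert_group = generate homeo_group (insert shift {f. inert f})"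

definition shift_exponent :: "(point \<Rightarrow> point) \<Rightarrow> int" where
  "shift_exponent f = (THE m. \<exists>g. inert g \<and> f = shift_pow m \<circ> g)"

definition inert_part :: "(point \<Rightarrow> point) \<Rightarrow> point \<Rightarrow> point" where
  "inert_part f = (THE g. inert g \<and> (\<exists>m. f = shift_pow m \<circ> g))"

text \<open>
  The words in \<open>{0,1}\<^bsup>[-R,R]\<^esup>\<close> are the extensional functions on \<open>{- int R..int R}\<close>.
\<close>

definition strong_radius :: "(point \<Rightarrow> point) \<Rightarrow> nat \<Rightarrow> bool" where
  "strong_radius g R \<longleftrightarrow>
    (\<exists>h \<in> ({- int R..int R} \<rightarrow>\<^sub>E UNIV) \<rightarrow> ({- int R..int R} \<rightarrow>\<^sub>E UNIV).
      \<forall>x. (\<forall>i. \<bar>i\<bar> > int R \<longrightarrow> g x i = x i) \<and>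
          (\<forall>i\<in>{- int R..int R}. g x i = h (restrict x {- int R..int R}) i))"

definition strong_shift_invariant_radius :: "(point \<Rightarrow> point) \<Rightarrow> nat" where
  "strong_shift_invariant_radius g =
    (LEAST R. \<exists>m. strong_radius (shift_pow m \<circ> g \<circ> shift_pow (- m)) R)"

definition periodic_points :: "nat \<Rightarrow> point set" where
  "periodic_points n = {x. (shift ^^ n) x = x}"

definition periodized :: "(point \<Rightarrow> point) \<Rightarrow> nat \<Rightarrow> nat \<Rightarrow> point \<Rightarrow> point" where
  "periodized g n k =
    foldr (\<circ>) (map (\<lambda>i. shift_pow (- i * int n) \<circ> g \<circ> shift_pow (i * int n)) [- int k..int k]) id"

definition periodic_action :: "nat \<Rightarrow> (point \<Rightarrow> point) \<Rightarrow> point \<Rightarrow> point" where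
  "periodic_action n f = (\<lambda>x\<in>periodic_points n.
    shift_pow (shift_exponent f) (lim (\<lambda>k. periodized (inert_part f) n k x)))"

definition periodic_extension :: "bool list \<Rightarrow> point" where
  "periodic_extension w = (\<lambda>i. w ! nat (i mod int (length w)))"

text \<open>
  The map \<open>f\<^sub>n\<close> on words of length \<open>n\<close> is extended by the identity to all lists, which is the
  convention of \<^const>\<open>permutes\<close>. It is meaningful when
  \<open>n > 2 * strong_shift_invariant_radius (inert_part f) + 1\<close>.
\<close>

definition word_map :: "nat \<Rightarrow> (point \<Rightarrow> point) \<Rightarrow> bool list \<Rightarrow> bool list" where
  "word_map n f w =
    (if length w = n
     then map (\<lambda>i. periodic_action n f (periodic_extension w) (int i)) [0..<n]
     else w)"

definition word_map_defined :: "nat \<Rightarrow> (point \<Rightarrow> point) \<Rightarrow> bool" where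
  "word_map_defined n f \<longleftrightarrow> n > 2 * strong_shift_invariant_radius (inert_part f) + 1"

definition words :: "nat \<Rightarrow> bool list set" where
  "words n = {w. length w = n}"

definition word_sym_group :: "nat \<Rightarrow> (bool list \<Rightarrow> bool list) monoid" where
  "word_sym_group n = \<lparr>carrier = {p. p permutes words n}, mult = (\<circ>), one = id\<rparr>"

definition word_alt :: "nat \<Rightarrow> (bool list \<Rightarrow> bool list) set" where
  "word_alt n = {p. p permutes words n \<and> evenperm p}"


subsection \<open>The notions above are well defined\<close>

lemma homeo_group_simps [simp]:
  "f \<otimes>\<^bsub>homeo_group\<^esub> g = f \<circ> g" "\<one>\<^bsub>homeo_group\<^esub> = id"
  by (simp_all add: homeo_group_def)

lemma carrier_homeo_group: "f \<in> carrier homeo_group \<longleftrightarrow> (\<exists>f'. homeomorphism UNIV UNIV f f')"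
  by (simp add: homeo_group_def)

lemma group_homeo_group: "group homeo_group"
proof (rule groupI)
  fix f g assume "f \<in> carrier homeo_group" "g \<in> carrier homeo_group"
  then show "f \<otimes>\<^bsub>homeo_group\<^esub> g \<in> carrier homeo_group"
    by (auto simp: carrier_homeo_group intro: homeomorphism_compose)
next
  fix f assume "f \<in> carrier homeo_group"
  then obtain f' where f': "homeomorphism UNIV UNIV f f'"
    by (auto simp: carrier_homeo_group)
  then have "f' \<circ> f = id" by (auto simp: homeomorphism_def)
  moreover have "f' \<in> carrier homeo_group"
    using homeomorphism_symD[OF f'] by (auto simp: carrier_homeo_group)
  ultimately show "\<exists>f'\<in>carrier homeo_group. f' \<otimes>\<^bsub>homeo_group\<^esub> f = \<one>\<^bsub>homeo_group\<^esub>"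
    by auto
next
  show "\<one>\<^bsub>homeo_group\<^esub> \<in> carrier homeo_group"
    using homeomorphism_ident[of UNIV] by (auto simp: carrier_homeo_group id_def)
qed (simp_all add: comp_assoc)

interpretation homeo: group homeo_group
  by (rule group_homeo_group)

lemma shift_homeomorphism:
  "homeomorphism UNIV UNIV (\<lambda>x::point. \<lambda>i. x (i + m)) (\<lambda>x i. x (i - m))"
proof -
  have surj: "surj (\<lambda>x::point. \<lambda>i. x (i + k))" for k
    by (rule surjI[of _ "\<lambda>x i. x (i - k)"]) auto
  have cont: "continuous_on UNIV (\<lambda>x::point. \<lambda>i. x (i + k))" for k
    by (intro continuous_on_coordinatewise_then_product) auto
  from surj[of m] surj[of "- m"] cont[of m] cont[of "- m"] show ?thesis
    by (auto simp: homeomorphism_def)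
qed

lemma shift_in_homeo_group [simp]: "shift \<in> carrier homeo_group"
  using shift_homeomorphism[of 1] by (auto simp: carrier_homeo_group shift_def[abs_def])

lemma shift_pow_in_homeo_group [simp]: "shift_pow m \<in> carrier homeo_group"
  by simp

lemma shift_funpow: "(shift ^^ n) x = (\<lambda>i. x (i + int n))"
  by (induction n arbitrary: x) (auto simp: shift_def algebra_simps)

lemma shift_pow_nat: "shift_pow (int n) = (\<lambda>x i. x (i + int n))"
proof -
  have "shift [^]\<^bsub>homeo_group\<^esub> n = (\<lambda>x i. x (i + int n))"
    by (induction n) (auto simp: shift_def fun_eq_iff algebra_simps)
  then show ?thesis by (simp add: int_pow_int)
qed

lemma shift_pow_eq: "shift_pow m = (\<lambda>x i. x (i + m))"
proof (cases "m \<ge> 0")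
  case True
  then show ?thesis using shift_pow_nat[of "nat m"] by simp
next
  case False
  then have 1: "shift_pow (- m) = (\<lambda>x i. x (i - m))" using shift_pow_nat[of "nat (- m)"] by simp
  have "shift_pow (- m) \<circ> shift_pow m = id"
    using homeo.int_pow_mult[of shift "- m" m] by simp
  then have "shift_pow (- m) (shift_pow m x) = x" for x by (simp add: fun_eq_iff)
  then have "shift_pow m x (i - m) = x i" for x i by (simp add: 1 fun_eq_iff)
  from this[of x "i + m" for x i] have "shift_pow m x i = x (i + m)" for x i
    by (simp only: add_diff_cancel_right')
  then show ?thesis by (intro ext)
qed

lemma shift_pow_zero: "shift_pow 0 = id"
  by (simp only: int_pow_0 homeo_group_simps)

lemma shift_pow_one: "shift_pow 1 = shift"
  by (rule homeo.int_pow_1) (rule shift_in_homeo_group)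

lemma inert_id: "inert id"
proof -
  have "id \<in> carrier homeo_group" using homeo.one_closed by (simp only: homeo_group_simps)
  then show ?thesis by (simp add: inert_def)
qed

lemma shift_inert_unique:
  assumes "inert g" "inert g'" and eq: "shift_pow m \<circ> g = shift_pow m' \<circ> g'"
  shows "m = m' \<and> g = g'"
proof -
  obtain r r' where r: "\<And>x i. \<bar>i\<bar> \<ge> r \<Longrightarrow> g x i = x i" "\<And>x i. \<bar>i\<bar> \<ge> r' \<Longrightarrow> g' x i = x i"
    using assms by (auto simp: inert_def)
  have e: "g x (i + m) = g' x (i + m')" for x i
    using eq by (auto simp: fun_eq_iff shift_pow_eq)
  define i where "i = \<bar>r\<bar> + \<bar>r'\<bar> + \<bar>m\<bar> + \<bar>m'\<bar>"
  have "x (i + m) = x (i + m')" for x :: point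
    using e[of x i] r by (auto simp: i_def)
  from this[of "\<lambda>j. j = i + m"] have "m = m'" by simp
  moreover have "g x i = g' x i" for x i using e[of x "i - m"] \<open>m = m'\<close> by simp
  ultimately show ?thesis by auto
qed

lemma shift_inert_decomposition:
  assumes "inert g"
  shows "shift_exponent (shift_pow m \<circ> g) = m" "inert_part (shift_pow m \<circ> g) = g"
proof -
  show "shift_exponent (shift_pow m \<circ> g) = m"
    unfolding shift_exponent_def
  proof (rule the_equality)
    fix k assume "\<exists>h. inert h \<and> shift_pow m \<circ> g = shift_pow k \<circ> h"
    then obtain h where "inert h" "shift_pow m \<circ> g = shift_pow k \<circ> h" by auto
    from shift_inert_unique[OF assms this] show "k = m" by simp
  qed (use assms in auto)
  show "inert_part (shift_pow m \<circ> g) = g"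
    unfolding inert_part_def
  proof (rule the_equality)
    fix h assume "inert h \<and> (\<exists>k. shift_pow m \<circ> g = shift_pow k \<circ> h)"
    then obtain k where "inert h" "shift_pow m \<circ> g = shift_pow k \<circ> h" by auto
    from shift_inert_unique[OF assms this] show "h = g" by simp
  qed (use assms in auto)
qed

lemma inert_comp: "inert f \<Longrightarrow> inert g \<Longrightarrow> inert (f \<circ> g)"
proof -
  assume f: "inert f" and g: "inert g"
  then obtain r s where "\<And>x i. \<bar>i\<bar> \<ge> r \<Longrightarrow> f x i = x i" "\<And>x i. \<bar>i\<bar> \<ge> s \<Longrightarrow> g x i = x i"
    by (auto simp: inert_def)
  then have "\<forall>x i. \<bar>i\<bar> \<ge> max r s \<longrightarrow> (f \<circ> g) x i = x i" by auto
  moreover have "f \<circ> g \<in> carrier homeo_group"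
    using homeo.m_closed[of f g] f g by (simp add: inert_def)
  ultimately show ?thesis unfolding inert_def by blast
qed

lemma inv_comp_cancel:
  assumes "f \<in> carrier homeo_group"
  shows "f ((inv\<^bsub>homeo_group\<^esub> f) x) = x" "(inv\<^bsub>homeo_group\<^esub> f) (f x) = x"
  using homeo.r_inv[OF assms] homeo.l_inv[OF assms] by (simp_all add: fun_eq_iff)

lemma inert_inv:
  assumes "inert f" shows "inert (inv\<^bsub>homeo_group\<^esub> f)"
proof -
  have f: "f \<in> carrier homeo_group" using assms by (simp add: inert_def)
  obtain r where r: "\<And>x i. \<bar>i\<bar> \<ge> r \<Longrightarrow> f x i = x i" using assms by (auto simp: inert_def)
  have "(inv\<^bsub>homeo_group\<^esub> f) x i = x i" if "\<bar>i\<bar> \<ge> r" for x i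
    using r[OF that, of "(inv\<^bsub>homeo_group\<^esub> f) x"] inv_comp_cancel[OF f] by simp
  with f show ?thesis by (auto simp: inert_def)
qed

lemma inert_conj:
  assumes "inert g" shows "inert (shift_pow (- m) \<circ> g \<circ> shift_pow m)"
proof -
  have g: "g \<in> carrier homeo_group" using assms by (simp add: inert_def)
  obtain r where r: "\<And>x i. \<bar>i\<bar> \<ge> r \<Longrightarrow> g x i = x i" using assms by (auto simp: inert_def)
  have "\<forall>x i. \<bar>i\<bar> \<ge> r + \<bar>m\<bar> \<longrightarrow> (shift_pow (- m) \<circ> g \<circ> shift_pow m) x i = x i"
    using r by (auto simp: shift_pow_eq)
  moreover have "shift_pow (- m) \<circ> g \<circ> shift_pow m \<in> carrier homeo_group"
    using g homeo.m_closed[OF homeo.m_closed[OF shift_pow_in_homeo_group g]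
      shift_pow_in_homeo_group] by simp
  ultimately show ?thesis unfolding inert_def by blast
qed

lemma shift_pow_comp: "shift_pow m \<circ> shift_pow k = shift_pow (m + k)"
  by (auto simp: shift_pow_eq fun_eq_iff algebra_simps)

lemma shift_inert_group_decomposition:
  assumes "f \<in> shift_inert_group"
  shows "\<exists>m g. inert g \<and> f = shift_pow m \<circ> g"
  using assms unfolding shift_inert_group_def
proof (induction f rule: generate.induct)
  case one
  have "id = shift_pow 0 \<circ> id" by (simp only: shift_pow_zero o_id)
  with inert_id show ?case unfolding homeo_group_simps by (intro exI conjI)
next
  case (incl h)
  then consider "h = shift" | "inert h" by auto
  then show ?case
  proof cases
    case 1
    then have "h = shift_pow 1 \<circ> id" by (simp only: shift_pow_one o_id)
    with inert_id show ?thesis by (intro exI conjI)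
  next
    case 2
    have "h = shift_pow 0 \<circ> h" by (simp only: shift_pow_zero id_o)
    with 2 show ?thesis by (intro exI conjI)
  qed
next
  case (inv h)
  then consider "h = shift" | "inert h" by auto
  then show ?case
  proof cases
    case 1
    then have "inv\<^bsub>homeo_group\<^esub> h = shift_pow (- 1) \<circ> id"
      using homeo.int_pow_neg[OF shift_in_homeo_group, of 1] by (simp only: shift_pow_one o_id)
    with inert_id show ?thesis by (intro exI conjI)
  next
    case 2
    have "inv\<^bsub>homeo_group\<^esub> h = shift_pow 0 \<circ> inv\<^bsub>homeo_group\<^esub> h"
      by (simp only: shift_pow_zero id_o)
    with inert_inv[OF 2] show ?thesis by (intro exI conjI)
  qed
next
  case (eng h1 h2)
  then obtain m1 g1 m2 g2 where *: "inert g1" "inert g2"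
    "h1 = shift_pow m1 \<circ> g1" "h2 = shift_pow m2 \<circ> g2" by blast
  have "h1 \<otimes>\<^bsub>homeo_group\<^esub> h2
      = shift_pow (m1 + m2) \<circ> ((shift_pow (- m2) \<circ> g1 \<circ> shift_pow m2) \<circ> g2)"
    by (auto simp: * shift_pow_eq fun_eq_iff)
  with inert_comp[OF inert_conj[OF *(1)] *(2)] show ?case by (intro exI conjI)
qed

lemma periodic_extension_periodic: "periodic_extension w \<in> periodic_points (length w)"
  by (simp add: periodic_points_def shift_funpow periodic_extension_def)

lemma periodic_extension_nth: "i < length w \<Longrightarrow> periodic_extension w (int i) = w ! i"
  by (simp add: periodic_extension_def)

lemma periodized_id [simp]: "periodized id n k = id"
proof -
  have "foldr (\<circ>) (map (\<lambda>i. shift_pow (- i * int n) \<circ> id \<circ> shift_pow (i * int n)) js) id = id" for js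
    by (induction js) (simp_all add: shift_pow_comp)
  then show ?thesis unfolding periodized_def .
qed

lemma word_map_shift: "word_map (Suc (length w)) shift (a # w) = w @ [a]"
proof -
  have s: "shift = shift_pow 1 \<circ> id" by (simp only: shift_pow_one o_id)
  have "shift_exponent shift = 1" "inert_part shift = id"
    by (subst s, rule shift_inert_decomposition[OF inert_id])+
  moreover have "lim (\<lambda>k::nat. x) = x" for x :: point
    by (simp add: tendsto_Lim)
  ultimately have *: "periodic_action (Suc (length w)) shift (periodic_extension (a # w))
      = shift (periodic_extension (a # w))"
    using periodic_extension_periodic[of "a # w"]
    by (simp add: periodic_action_def)
  show ?thesis
  proof (rule nth_equalityI)
    fix i assume "i < length (word_map (Suc (length w)) shift (a # w))"
    then have i: "i \<le> length w" by (simp add: word_map_def)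
    have "word_map (Suc (length w)) shift (a # w) ! i = periodic_extension (a # w) (int i + 1)"
      using i by (simp add: word_map_def * shift_def nth_append del: upt_Suc)
    also have "\<dots> = (w @ [a]) ! i"
      using i periodic_extension_nth[of "Suc i" "a # w"]
      by (cases "i = length w") (auto simp: nth_append periodic_extension_def add.commute)
    finally show "word_map (Suc (length w)) shift (a # w) ! i = (w @ [a]) ! i" .
  qed (simp add: word_map_def)
qed

end

theory Submission
  imports Defs
begin

text \<open>
  For fixed \<open>f, h \<in> G\<close>, \<open>(f \<circ> h)\<^sub>n = f\<^sub>n \<circ> h\<^sub>n\<close> as soon as \<open>n\<close> is large. Hence any fixed
  element of \<open>G\<close>, being a word in \<open>F\<close>, has its image in the group generated by the \<open>f\<^sub>n\<close>
  for large \<open>n\<close>, and it suffices to do the following.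

  \<^item> Each \<open>f\<^sub>n\<close> is even: an inert map leaves some bit of a long word alone and acts independently of
    it, and the rotation is a product of swaps of two bits, which ignore a third bit.

  \<^item> The rotation, the swap of the first two bits, one negation and one Toffoli gate generate the
    alternating group. Commutators using a borrowed bit give all negations of a bit controlled by
    at most \<open>n - 2\<close> other bits. Two of these, whose supports meet in a single word \<open>w\<close>, have as
    commutator a 3-cycle on \<open>w\<close> and two of its neighbours in the hypercube, and such 3-cycles
    generate the alternating group.
\<close>

subsection \<open>Even permutations of the hypercube\<close>

lemma finite_words [simp]: "finite (words n)"
  using finite_lists_length_eq[of "UNIV :: bool set" n] by (simp add: words_def)

definition bit_flip :: "nat \<Rightarrow> bool list \<Rightarrow> bool list" where
  "bit_flip i w = w[i := \<not> w ! i]"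

lemma length_bit_flip [simp]: "length (bit_flip i w) = length w"
  by (simp add: bit_flip_def)

lemma nth_bit_flip: "j < length w \<Longrightarrow> bit_flip i w ! j = (w ! j \<noteq> (i = j))"
  by (auto simp: bit_flip_def nth_list_update)

lemma bit_flip_bit_flip [simp]: "bit_flip i (bit_flip i w) = w"
  by (rule nth_equalityI) (auto simp: nth_bit_flip)

lemma bit_flip_neq: "i < length w \<Longrightarrow> bit_flip i w \<noteq> w"
  by (metis nth_bit_flip)

text \<open>Induction on the number of set bits: flipping a set bit leads to a word closer to the
  zero word, and flipping it again returns along the same edge of the hypercube.\<close>

lemma words_connected:
  assumes "P (replicate n False)"
    and "\<And>w i. \<lbrakk>P w; length w = n; i < n\<rbrakk> \<Longrightarrow> P (bit_flip i w)"
    and "length w = n"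
  shows "P w"
  using assms(3)
proof (induction "card {i. i < n \<and> w ! i}" arbitrary: w)
  case 0
  then have "w = replicate n False" by (auto intro: nth_equalityI)
  with assms(1) show ?case by simp
next
  case (Suc m)
  then obtain i where i: "i < n" "w ! i" by (metis (no_types, lifting) card.empty empty_Collect_eq nat.simps(3))
  have "{j. j < n \<and> bit_flip i w ! j} = {j. j < n \<and> w ! j} - {i}"
    using Suc(3) i by (auto simp: nth_bit_flip)
  then have "card {j. j < n \<and> bit_flip i w ! j} = m" using i Suc(2) by simp
  with Suc have "P (bit_flip i w)" by simp
  from assms(2)[OF this, of i] i Suc(3) show ?case by simp
qed

text \<open>
  Modulo \<open>K\<close>, all edge transpositions of the hypercube are equal, because the hypercube is
  connected, and then so are all transpositions, as \<open>(a c) = (a b)(b c)(a b)\<close>. An even permutation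
  is a product of pairs of transpositions.
\<close>

lemma even_permutations_from_paths:
  assumes id: "id \<in> K" and comp: "\<And>p q. \<lbrakk>p \<in> K; q \<in> K\<rbrakk> \<Longrightarrow> p \<circ> q \<in> K"
    and path: "\<And>w i j. \<lbrakk>length w = n; i < n; j < n; i \<noteq> j\<rbrakk> \<Longrightarrow>
      transpose w (bit_flip i w) \<circ> transpose w (bit_flip j w) \<in> K"
    and p: "p permutes words n" "evenperm p"
  shows "p \<in> K"
proof (cases "n = 0")
  \<comment> \<open>The hypercube of dimension 0 has no edge that could serve as the reference
    transposition \<open>e\<close>.\<close>
  case True
  then have "words n = {[]}" by (auto simp: words_def)
  with p have "p = id" by simp
  with id show ?thesis by simp
next
  case False
  define z where "z = replicate n False"
  define e where "e = transpose z (bit_flip 0 z)"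
  have z: "length z = n" by (simp add: z_def)
  have ee: "e \<circ> e = id" by (simp add: e_def)
  \<comment> \<open>\<open>S a b\<close> expresses that the transposition of \<open>a\<close> and
    \<open>b\<close> is congruent to \<open>e\<close> modulo \<open>K\<close>. Both orders are
    recorded because the only closure property at hand is closure under composition.\<close>
  define S where "S a b \<longleftrightarrow> e \<circ> transpose a b \<in> K \<and> transpose a b \<circ> e \<in> K" for a b
  have S_sym: "S a b \<Longrightarrow> S b a" for a b by (simp add: S_def transpose_commute)
  have S_pair: "transpose a b \<circ> transpose c d \<in> K" if "S a b" "S c d" for a b c d
  proof -
    have "transpose a b \<circ> transpose c d = (transpose a b \<circ> e) \<circ> (e \<circ> transpose c d)"
      using ee by (simp add: fun_eq_iff)
    with that comp show ?thesis by (simp only: S_def)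
  qed
  have S_step: "S c d" if "S a b" "transpose a b \<circ> transpose c d \<in> K" "transpose c d \<circ> transpose a b \<in> K"
    for a b c d
  proof -
    have "e \<circ> transpose c d = (e \<circ> transpose a b) \<circ> (transpose a b \<circ> transpose c d)"
      "transpose c d \<circ> e = (transpose c d \<circ> transpose a b) \<circ> (transpose a b \<circ> e)"
      by (simp_all add: fun_eq_iff)
    with that comp show ?thesis by (simp only: S_def)
  qed
  have S_trans: "S a c" if "S a b" "S b c" "a \<noteq> c" "a \<noteq> b" "b \<noteq> c" for a b c
  proof -
    have *: "transpose a c = transpose a b \<circ> (transpose b c \<circ> transpose a b)"
      using transpose_comp_triple[of a c b] that by (simp add: comp_assoc)
    have "transpose a c \<circ> e = (transpose a b \<circ> transpose b c) \<circ> (transpose a b \<circ> e)"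
      "e \<circ> transpose a c = (e \<circ> transpose a b) \<circ> (transpose b c \<circ> transpose a b)"
      by (simp_all only: *) (simp_all only: comp_assoc)
    moreover have "transpose a b \<circ> e \<in> K" "e \<circ> transpose a b \<in> K"
      using that(1) by (simp_all only: S_def)
    ultimately show ?thesis
      unfolding S_def using S_pair[OF that(1,2)] S_pair[OF that(2,1)] comp by metis
  qed
  \<comment> \<open>By \<open>path\<close>, edges at a common vertex are congruent modulo
    \<open>K\<close>, so one good edge makes the whole star good.\<close>
  have star: "S w (bit_flip j w)" if "S w (bit_flip i w)" "length w = n" "i < n" "j < n" for w i j
    using S_step[OF that(1) path path, of j] that by (cases "i = j") auto
  \<comment> \<open>An edge lies in the stars of both its endpoints, so goodness spreads from
    \<open>e\<close> over the connected hypercube.\<close>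
  have edges: "\<forall>j<n. S w (bit_flip j w)" if "length w = n" for w
  proof (rule words_connected[where P = "\<lambda>w. \<forall>j<n. S w (bit_flip j w)" and n = n])
    have "S z (bit_flip 0 z)" using id ee by (simp add: S_def e_def)
    then show "\<forall>j<n. S (replicate n False) (bit_flip j (replicate n False))"
      using star[of z 0] False z unfolding z_def by blast
  next
    fix w i assume *: "\<forall>j<n. S w (bit_flip j w)" "length w = n" "i < n"
    then have "S (bit_flip i w) (bit_flip i (bit_flip i w))" using S_sym[of w] by simp
    then show "\<forall>j<n. S (bit_flip i w) (bit_flip j (bit_flip i w))"
      using star[of "bit_flip i w" i] * by (metis length_bit_flip)
  qed (fact that)
  have from_z: "w = z \<or> S z w" if "length w = n" for w
  proof (rule words_connected[where P = "\<lambda>w. w = z \<or> S z w" and n = n])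
    fix w i assume *: "w = z \<or> S z w" "length w = n" "i < n"
    then have "S w (bit_flip i w)" using edges by auto
    with * S_trans[of z w "bit_flip i w"] bit_flip_neq[of i w]
    show "bit_flip i w = z \<or> S z (bit_flip i w)" by (cases "z = w") auto
  qed (use that in \<open>simp_all add: z_def\<close>)
  have all: "S a b" if "a \<in> words n" "b \<in> words n" "a \<noteq> b" for a b
    using from_z[of a] from_z[of b] S_trans[of a z b] S_sym[of z a] that unfolding words_def by blast
  \<comment> \<open>The odd case, corrected by one \<open>e\<close>, is carried along so that the
    induction can add single transpositions.\<close>
  from p(1) finite_words have "(evenperm p \<longrightarrow> p \<in> K) \<and> (\<not> evenperm p \<longrightarrow> e \<circ> p \<in> K)"
  proof (induction p rule: permutes_induct)
    case (swap a b p)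
    have "permutation p" by (rule permutes_imp_permutation[OF finite_words]) (rule swap)
    then have ev: "evenperm (transpose a b \<circ> p) \<longleftrightarrow> \<not> evenperm p"
      using swap by (simp add: evenperm_comp evenperm_swap permutation_swap_id)
    have 1: "e \<circ> (transpose a b \<circ> p) = (e \<circ> transpose a b) \<circ> p"
      and 2: "transpose a b \<circ> p = (transpose a b \<circ> e) \<circ> (e \<circ> p)"
      using ee by (simp_all add: fun_eq_iff)
    have "S a b" using swap by (intro all)
    then have "e \<circ> (transpose a b \<circ> p) \<in> K" if "evenperm p"
      unfolding 1 S_def using swap that comp by blast
    moreover have "transpose a b \<circ> p \<in> K" if "\<not> evenperm p"
      unfolding 2 using \<open>S a b\<close> unfolding S_def using swap that comp by blast
    ultimately show ?case using ev by blast
  qed (use id in \<open>simp add: id_def\<close>)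
  with p show ?thesis by simp
qed

subsection \<open>Controlled negations and permutations of bits\<close>

text \<open>The generalized Toffoli gate with control set \<open>C\<close> and target
  \<open>t\<close>; the pattern \<open>x\<close> also allows controls that must be False. Words of
  other lengths stay fixed, as \<open>permutes\<close> requires.\<close>

definition cnot :: "nat \<Rightarrow> nat set \<Rightarrow> (nat \<Rightarrow> bool) \<Rightarrow> nat \<Rightarrow> bool list \<Rightarrow> bool list" where
  "cnot n C x t w = (if length w = n \<and> (\<forall>c\<in>C. w ! c = x c) then bit_flip t w else w)"

lemma length_cnot [simp]: "length (cnot n C x t w) = length w"
  by (simp add: cnot_def)

lemma nth_cnot:
  "\<lbrakk>length w = n; i < n\<rbrakk> \<Longrightarrow> cnot n C x t w ! i = (w ! i \<noteq> (t = i \<and> (\<forall>c\<in>C. w ! c = x c)))"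
  by (auto simp: cnot_def nth_bit_flip)

lemma cnot_outside: "length w \<noteq> n \<Longrightarrow> cnot n C x t w = w"
  by (simp add: cnot_def)

text \<open>Only bit \<open>t\<close> can change, and it is not in \<open>C\<close>. As a rewrite
  rule this evaluates the controls through a composition of gates.\<close>

lemma agree_cnot:
  assumes "t \<notin> C" "C \<subseteq> {..<n}" "length w = n"
  shows "(\<forall>c\<in>C. cnot n D y t w ! c = x c) \<longleftrightarrow> (\<forall>c\<in>C. w ! c = x c)"
  using assms by (intro ball_cong) (auto simp: nth_cnot)

lemma cnot_involution:
  assumes "t \<notin> C" "C \<subseteq> {..<n}"
  shows "cnot n C x t (cnot n C x t w) = w"
  using agree_cnot[OF assms, of w C x x] by (auto simp: cnot_def)

lemma cnot_cong:
  assumes "\<And>c. c \<in> C \<Longrightarrow> x c = y c"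
  shows "cnot n C x t = cnot n C y t"
proof -
  have "(\<forall>c\<in>C. w ! c = x c) \<longleftrightarrow> (\<forall>c\<in>C. w ! c = y c)" for w :: "bool list"
    using assms by (intro ball_cong) simp_all
  then show ?thesis by (simp add: cnot_def fun_eq_iff)
qed

lemma word_fun_eqI:
  assumes "\<And>w. length w \<noteq> n \<Longrightarrow> f w = g w"
    and "\<And>w. length w = n \<Longrightarrow> length (f w) = n \<and> length (g w) = n"
    and "\<And>w i. \<lbrakk>length w = n; i < n\<rbrakk> \<Longrightarrow> f w ! i = g w ! i"
  shows "f = g"
proof
  fix w show "f w = g w"
  proof (cases "length w = n")
    case True
    show ?thesis using assms(2,3)[OF True] by (intro nth_equalityI) simp_all
  qed (rule assms(1))
qed

text \<open>
  Bit \<open>a\<close> serves as a borrowed bit: it holds an arbitrary value, which the commutator restores.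
\<close>

lemma cnot_commutator:
  assumes "a \<notin> C" "a \<notin> D" "a \<noteq> t" "t \<notin> C" "t \<notin> D" "C \<subseteq> {..<n}" "D \<subseteq> {..<n}" "a < n" "t < n"
  shows "cnot n C x a \<circ> cnot n (insert a D) x t \<circ> cnot n C x a \<circ> cnot n (insert a D) x t
    = cnot n (C \<union> D) x t"
proof (rule word_fun_eqI[where n = n])
  fix w :: "bool list" and i assume w: "length w = n" and i: "i < n"
  show "(cnot n C x a \<circ> cnot n (insert a D) x t \<circ> cnot n C x a \<circ> cnot n (insert a D) x t) w ! i
    = cnot n (C \<union> D) x t w ! i"
    using assms w i
    by (simp add: nth_cnot agree_cnot ball_Un) blast
qed (simp_all add: cnot_outside)

text \<open>The supports of the two involutions meet only in \<open>z\<close>, so \<open>f\<close>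
  fixes \<open>h z\<close> and \<open>h\<close> fixes \<open>f z\<close>, and the commutator is a
  3-cycle on \<open>z\<close>, \<open>f z\<close> and \<open>h z\<close>. Any other word is moved by
  at most one of the two maps, whose two occurrences cancel because its support is invariant under
  it.\<close>

lemma commutator_single_overlap:
  assumes "\<And>w. f (f w) = w" "\<And>w. h (h w) = w" "f z \<noteq> z" "h z \<noteq> z"
    and "\<And>w. f w \<noteq> w \<Longrightarrow> h w \<noteq> w \<Longrightarrow> w = z"
  shows "f \<circ> h \<circ> f \<circ> h = transpose z (h z) \<circ> transpose z (f z)"
proof
  fix w
  have 1: "h (f z) = f z" "f (h z) = h z"
    using assms(5)[of "f z"] assms(5)[of "h z"] assms(3,4) assms(1,2)[of z] by auto
  show "(f \<circ> h \<circ> f \<circ> h) w = (transpose z (h z) \<circ> transpose z (f z)) w"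
  proof (cases "w = z \<or> w = f z \<or> w = h z")
    case True
    then show ?thesis using 1 assms(1,2)[of z] assms(3,4) by (auto simp: transpose_def)
  next
    case False
    then have n: "f w \<noteq> z" "h w \<noteq> z" using assms(1)[of w] assms(2)[of w] by auto
    consider "f w = w" | "h w = w" using False assms(5) by blast
    then have "f (h (f (h w))) = w"
    proof cases
      case 1
      then have "f (h w) = h w"
        using assms(5)[of "h w"] n assms(2)[of w] by (cases "h w = w") auto
      then show ?thesis by (simp add: assms(2) 1)
    next
      case 2
      then have "h (f w) = f w"
        using assms(5)[of "f w"] n assms(1)[of w] by (cases "f w = w") auto
      then show ?thesis by (simp add: assms(1) 2)
    qed
    then show ?thesis using False by (simp add: transpose_def)
  qed
qed

section \<open>Permutations of bit positions\<close>

definition bit_perm :: "nat \<Rightarrow> (nat \<Rightarrow> nat) \<Rightarrow> bool list \<Rightarrow> bool list" where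
  "bit_perm n \<pi> w = (if length w = n then map (\<lambda>i. w ! \<pi> i) [0..<n] else w)"

lemma length_bit_perm [simp]: "length (bit_perm n \<pi> w) = length w"
  by (simp add: bit_perm_def)

lemma nth_bit_perm: "\<lbrakk>length w = n; i < n\<rbrakk> \<Longrightarrow> bit_perm n \<pi> w ! i = w ! \<pi> i"
  by (simp add: bit_perm_def)

lemma bit_perm_outside: "length w \<noteq> n \<Longrightarrow> bit_perm n \<pi> w = w"
  by (simp add: bit_perm_def)

text \<open>Words are functions of the position and are acted on by precomposition, which reverses
  the order of the factors.\<close>

lemma bit_perm_comp:
  assumes "\<pi> permutes {..<n}"
  shows "bit_perm n \<pi> \<circ> bit_perm n \<rho> = bit_perm n (\<rho> \<circ> \<pi>)"
proof (rule word_fun_eqI[where n = n])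
  fix w :: "bool list" and i assume w: "length w = n" and i: "i < n"
  then have "\<pi> i < n" using permutes_in_image[OF assms, of i] by simp
  with w i show "(bit_perm n \<pi> \<circ> bit_perm n \<rho>) w ! i = bit_perm n (\<rho> \<circ> \<pi>) w ! i"
    by (simp add: nth_bit_perm)
qed (simp_all add: bit_perm_outside)

lemma bit_perm_id [simp]: "bit_perm n id = id"
  by (rule word_fun_eqI[where n = n]) (simp_all add: bit_perm_outside nth_bit_perm)

lemma bit_perm_permutes:
  assumes "\<pi> permutes {..<n}"
  shows "bit_perm n \<pi> permutes words n"
    and "inv_into UNIV (bit_perm n \<pi>) = bit_perm n (inv_into UNIV \<pi>)"
proof -
  have i: "inv_into UNIV \<pi> permutes {..<n}" using assms by (rule permutes_inv)
  have "bit_perm n \<pi> \<circ> bit_perm n (inv_into UNIV \<pi>) = id" "bit_perm n (inv_into UNIV \<pi>) \<circ> bit_perm n \<pi> = id"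
    using bit_perm_comp[OF assms, of "inv_into UNIV \<pi>"] bit_perm_comp[OF i, of \<pi>] permutes_inv_o[OF assms]
    by simp_all
  then have "bij (bit_perm n \<pi>)" "inv_into UNIV (bit_perm n \<pi>) = bit_perm n (inv_into UNIV \<pi>)"
    by (auto simp: inv_unique_comp intro: o_bij)
  then show "bit_perm n \<pi> permutes words n" "inv_into UNIV (bit_perm n \<pi>) = bit_perm n (inv_into UNIV \<pi>)"
    by (simp_all add: permutes_def words_def bit_perm_outside bij_iff)
qed

text \<open>Conjugation by a permutation of positions renames controls and target, so one gate
  yields its copies on all other bits.\<close>

lemma cnot_bit_perm:
  assumes \<pi>: "\<pi> permutes {..<n}" and C: "C \<subseteq> {..<n}" "t < n"
  shows "bit_perm n \<pi> \<circ> cnot n (\<pi> ` C) x (\<pi> t) \<circ> bit_perm n (inv_into UNIV \<pi>) = cnot n C (x \<circ> \<pi>) t"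
proof (rule word_fun_eqI[where n = n])
  fix w :: "bool list" and i assume w: "length w = n" and i: "i < n"
  have lt: "\<pi> j < n" if "j < n" for j using permutes_in_image[OF \<pi>, of j] that by simp
  have ag: "(\<forall>c\<in>C. bit_perm n (inv_into UNIV \<pi>) w ! \<pi> c = x (\<pi> c)) \<longleftrightarrow> (\<forall>c\<in>C. w ! c = x (\<pi> c))"
    using C w lt by (intro ball_cong) (auto simp: nth_bit_perm permutes_inverses[OF \<pi>] subset_iff)
  show "(bit_perm n \<pi> \<circ> cnot n (\<pi> ` C) x (\<pi> t) \<circ> bit_perm n (inv_into UNIV \<pi>)) w ! i
      = cnot n C (x \<circ> \<pi>) t w ! i"
    using w i lt[OF i] permutes_inj[OF \<pi>]
    by (auto simp: nth_bit_perm nth_cnot permutes_inverses[OF \<pi>] ag inj_eq)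
qed (simp_all add: bit_perm_outside cnot_outside)

text \<open>Negating a control before and after the gate inverts the value required there. This
  reaches every pattern from the constant one.\<close>

lemma cnot_not_conj:
  assumes "a \<noteq> t" "a < n" "t < n" "C \<subseteq> {..<n}" "a \<in> C"
  shows "cnot n {} y a \<circ> cnot n C x t \<circ> cnot n {} y a = cnot n C (x(a := \<not> x a)) t"
proof (rule word_fun_eqI[where n = n])
  fix w :: "bool list" and i assume w: "length w = n" and i: "i < n"
  have ag: "(\<forall>c\<in>C. cnot n {} y a w ! c = x c) \<longleftrightarrow> (\<forall>c\<in>C. w ! c = (x(a := \<not> x a)) c)"
    using assms w by (intro ball_cong) (auto simp: nth_cnot)
  show "(cnot n {} y a \<circ> cnot n C x t \<circ> cnot n {} y a) w ! i = cnot n C (x(a := \<not> x a)) t w ! i"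
    using w i assms by (simp add: nth_cnot ag) auto
qed (simp_all add: cnot_outside)

lemma permutes_by_inverse:
  assumes "p \<circ> q = id" "q \<circ> p = id" "\<And>x. x \<notin> S \<Longrightarrow> p x = x"
  shows "p permutes S"
  using o_bij[OF assms(2,1)] assms(3) by (simp add: permutes_def bij_iff)

text \<open>The position map of the left rotation, which is the word map of the shift. It is the
  identity from \<open>n\<close> on in order to permute \<open>{..<n}\<close>.\<close>

definition rot :: "nat \<Rightarrow> nat \<Rightarrow> nat" where
  "rot n i = (if Suc i < n then Suc i else if Suc i = n then 0 else i)"

lemma rot_permutes: "rot n permutes {..<n}"
proof (rule permutes_by_inverse)
  define q where "q i = (if i = 0 then n - 1 else if i < n then i - 1 else i)" for i
  show "rot n \<circ> q = id" "q \<circ> rot n = id" by (auto simp: rot_def q_def fun_eq_iff)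
qed (simp add: rot_def)

section \<open>Generating the alternating group from four gates\<close>

text \<open>\<open>K\<close> stands for the group generated by the word maps of \<open>F\<close>.
  The four gates are word maps of fixed elements of the group G, so they lie in \<open>K\<close> for
  large \<open>n\<close>.\<close>

locale word_gates =
  fixes n :: nat and K :: "(bool list \<Rightarrow> bool list) set"
  assumes n_ge: "4 \<le> n"
    and id_in: "id \<in> K"
    and comp_in: "\<lbrakk>p \<in> K; q \<in> K\<rbrakk> \<Longrightarrow> p \<circ> q \<in> K"
    and inv_in: "p \<in> K \<Longrightarrow> inv_into UNIV p \<in> K"
    and rot_in: "bit_perm n (rot n) \<in> K"
    and swap_in: "bit_perm n (transpose 0 1) \<in> K"
    and not_in: "cnot n {} (\<lambda>_. True) 0 \<in> K"
    and toffoli_in: "cnot n {0, 1} (\<lambda>_. True) 2 \<in> K"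
begin

text \<open>Conjugation by the rotation carries the swap of \<open>i\<close> and
  \<open>i + 1\<close> to the swap of the next two positions.\<close>

lemma adjacent_swap_in: "Suc i < n \<Longrightarrow> bit_perm n (transpose i (Suc i)) \<in> K"
proof (induction i)
  case 0
  then show ?case using swap_in by simp
next
  case (Suc i)
  let ?c = "rot n" and ?t = "transpose i (Suc i)"
  have c: "inv_into UNIV ?c permutes {..<n}" by (rule permutes_inv) (rule rot_permutes)
  have t: "?t permutes {..<n}" using Suc by (intro permutes_swap_id) auto
  have "?c i = Suc i" "?c (Suc i) = Suc (Suc i)" using Suc by (simp_all add: rot_def)
  then have "inv_into UNIV ?c (Suc i) = i" "inv_into UNIV ?c (Suc (Suc i)) = Suc i"
    using permutes_inverses(2)[OF rot_permutes] by metis+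
  then have "transpose (Suc i) (Suc (Suc i)) \<circ> ?c = ?c \<circ> ?t"
    using transpose_comp_eq[OF permutes_bij[OF rot_permutes], of "Suc i" "Suc (Suc i)" n] by simp
  then have "(?c \<circ> ?t) \<circ> inv_into UNIV ?c = transpose (Suc i) (Suc (Suc i)) \<circ> (?c \<circ> inv_into UNIV ?c)"
    by (simp only: comp_assoc[symmetric])
  then have "bit_perm n (transpose (Suc i) (Suc (Suc i))) =
    bit_perm n (inv_into UNIV ?c) \<circ> (bit_perm n ?t \<circ> bit_perm n ?c)"
    by (simp add: bit_perm_comp[OF c] bit_perm_comp[OF t] permutes_inv_o[OF rot_permutes])
  moreover have "bit_perm n (inv_into UNIV ?c) \<in> K"
    using inv_in[OF rot_in] by (simp only: bit_perm_permutes(2)[OF rot_permutes])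
  ultimately show ?case using comp_in Suc rot_in by (metis Suc_lessD)
qed

lemma swap_triple_in:
  assumes "bit_perm n (transpose a b) \<in> K" "bit_perm n (transpose b c) \<in> K"
    and "a < n" "b < n" "c < n" "a \<noteq> c" "b \<noteq> c"
  shows "bit_perm n (transpose a c) \<in> K"
proof -
  have "transpose a b permutes {..<n}" "transpose b c permutes {..<n}"
    using assms by (auto intro: permutes_swap_id)
  then have "bit_perm n (transpose a c) =
      bit_perm n (transpose a b) \<circ> (bit_perm n (transpose b c) \<circ> bit_perm n (transpose a b))"
    by (simp add: bit_perm_comp transpose_comp_triple[OF assms(6,7)])
  with assms(1,2) comp_in show ?thesis by (simp only:)
qed

lemma swap0_in: "i < n \<Longrightarrow> bit_perm n (transpose 0 i) \<in> K"
proof (induction i)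
  case (Suc i)
  then show ?case using adjacent_swap_in[of i] swap_triple_in[of 0 i "Suc i"] by simp
qed (simp add: id_in)

text \<open>Swaps with position 0 give all swaps by \<open>swap_triple_in\<close>, and swaps
  generate all permutations of positions.\<close>

lemma bit_perm_in:
  assumes "\<pi> permutes {..<n}"
  shows "bit_perm n \<pi> \<in> K"
  using assms finite_lessThan
proof (induction \<pi> rule: permutes_induct)
  case (swap a b \<pi>)
  have "bit_perm n (transpose a b) \<in> K"
  proof (cases "b = 0")
    case True
    with swap0_in[of a] swap show ?thesis by (simp add: transpose_commute)
  next
    case False
    with swap swap0_in[of a] swap0_in[of b] show ?thesis
      by (intro swap_triple_in[of a 0 b]) (auto simp: transpose_commute)
  qed
  then show ?case
    using swap comp_in bit_perm_comp[of \<pi> n "transpose a b"] by metis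
qed (simp only: bit_perm_id id_in)

lemma cnot_image_in:
  assumes "\<pi> permutes {..<n}" "C \<subseteq> {..<n}" "t < n" "cnot n (\<pi> ` C) x (\<pi> t) \<in> K"
  shows "cnot n C (x \<circ> \<pi>) t \<in> K"
  using cnot_bit_perm[OF assms(1-3), of x] comp_in[OF comp_in[OF bit_perm_in[OF assms(1)] assms(4)]
    bit_perm_in[OF permutes_inv[OF assms(1)]]]
  by (simp only:)

lemma not_gate_in:
  assumes "t < n"
  shows "cnot n {} x t \<in> K"
proof -
  have "transpose 0 t permutes {..<n}" using assms by (intro permutes_swap_id) auto
  from cnot_image_in[OF this _ assms, of "{}" "\<lambda>_. True"] not_in
  have "cnot n {} ((\<lambda>_. True) \<circ> transpose 0 t) t \<in> K" by simp
  then show ?thesis by (simp add: cnot_def[abs_def])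
qed

lemma cnot_flip_pattern:
  assumes "cnot n C x t \<in> K" "C \<subseteq> {..<n}" "t < n" "t \<notin> C" "a \<in> C"
  shows "cnot n C (x(a := y)) t \<in> K"
proof (cases "y = x a")
  case False
  then have "x(a := y) = x(a := \<not> x a)" by auto
  moreover have "a \<noteq> t" "a < n" using assms by auto
  ultimately show ?thesis
    using cnot_not_conj[of a t n C _ x] assms comp_in not_gate_in[of a] by metis
qed (use assms in simp)

lemma toffoli_gate_in:
  assumes "a < n" "b < n" "t < n" "a \<noteq> b" "a \<noteq> t" "b \<noteq> t"
  shows "cnot n {a, b} x t \<in> K"
proof -
  \<comment> \<open>The three swaps move \<open>a\<close>, \<open>b\<close>, \<open>t\<close> to the
    positions 0, 1, 2 one after another; each later swap fixes the positions already filled.\<close>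
  define p where "p = transpose a 0"
  define q where "q = transpose (p b) 1"
  define r where "r = transpose (q (p t)) 2"
  have lt: "p i < n" "q i < n" if "i < n" for i
    using that assms n_ge by (auto simp: p_def q_def transpose_def)
  have perm: "p permutes {..<n}" "q permutes {..<n}" "r permutes {..<n}"
    by (subst p_def q_def r_def, rule permutes_swap_id; use lt assms n_ge in simp)+
  then have perm': "r \<circ> q \<circ> p permutes {..<n}" by (intro permutes_compose) simp_all
  have "p a = 0" by (simp add: p_def)
  moreover have "q (p b) = 1" by (simp add: q_def)
  moreover have "r (q (p t)) = 2" by (simp add: r_def)
  moreover have inj: "p b \<noteq> p a" "p t \<noteq> p a" "q (p t) \<noteq> q (p b)" "q (p t) \<noteq> q (p a)"
    using assms perm[THEN permutes_inj] by (simp_all add: inj_eq)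
  moreover from this have "q 0 = 0" using \<open>p a = 0\<close> by (simp add: q_def)
  moreover have "r 0 = 0" "r 1 = 1"
    using inj(3,4) \<open>p a = 0\<close> \<open>q 0 = 0\<close> \<open>q (p b) = 1\<close> by (simp_all add: r_def)
  ultimately have "(r \<circ> q \<circ> p) ` {a, b} = {0, 1}" "(r \<circ> q \<circ> p) t = 2" by auto
  with cnot_image_in[OF perm', of "{a, b}" t "\<lambda>_. True"] toffoli_in assms
  have "cnot n {a, b} (\<lambda>_. True) t \<in> K" by (simp add: o_def)
  then have "cnot n {a, b} ((\<lambda>_. True)(a := x a)) t \<in> K"
    by (rule cnot_flip_pattern) (use assms in auto)
  then have "cnot n {a, b} ((\<lambda>_. True)(a := x a, b := x b)) t \<in> K"
    by (rule cnot_flip_pattern) (use assms in auto)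
  moreover have "cnot n {a, b} ((\<lambda>_. True)(a := x a, b := x b)) t = cnot n {a, b} x t"
    by (rule cnot_cong) auto
  ultimately show ?thesis by simp
qed

text \<open>Induction on the number of controls. By \<open>cnot_commutator\<close> the gate is a
  commutator of a Toffoli gate, which writes the conjunction of two controls into a borrowed bit,
  and a gate in which the borrowed bit replaces these two controls.\<close>

lemma cnot_in:
  assumes "C \<subseteq> {..<n}" "t < n" "t \<notin> C" "2 \<le> card C" "card C + 2 \<le> n"
  shows "cnot n C x t \<in> K"
  using assms
proof (induction "card C" arbitrary: C t rule: less_induct)
  case less
  have fin: "finite C" using less.prems(1) finite_subset by blast
  obtain c where c: "c \<in> C" using less.prems(4) by fastforce
  have "card (C - {c}) \<noteq> 0" using c fin less.prems(4) by simp
  then have "C - {c} \<noteq> {}" by (metis card.empty)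
  then obtain d where d: "d \<in> C" "d \<noteq> c" by blast
  show ?case
  proof (cases "card C = 2")
    case True
    then have "C = {c, d}" using c d fin by (intro card_subset_eq[symmetric]) auto
    then show ?thesis using toffoli_gate_in[of c d t x] less.prems d by auto
  next
    case False
    define D where "D = C - {c, d}"
    have D: "card D + 2 = card C" "finite D" "D \<subseteq> C" "C = {c, d} \<union> D"
      using c d fin less.prems(4) by (auto simp: D_def card_Diff_subset)
    \<comment> \<open>The bound \<open>card C + 2 \<le> n\<close> leaves a bit that is neither
      control nor target; this is the bit to borrow.\<close>
    have "card (insert t C) < card {..<n}" using less.prems fin by simp
    then have "\<not> {..<n} \<subseteq> insert t C" using fin by (metis card_mono finite_insert not_le)
    then obtain a where a: "a < n" "a \<noteq> t" "a \<notin> C" by auto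
    have "cnot n {c, d} x a \<in> K"
      using a c d less.prems by (intro toffoli_gate_in) auto
    moreover have "cnot n (insert a D) x t \<in> K"
      using less.prems D False a by (intro less.hyps) auto
    moreover have "cnot n C x t = cnot n {c, d} x a \<circ> cnot n (insert a D) x t
        \<circ> cnot n {c, d} x a \<circ> cnot n (insert a D) x t"
      using a c d less.prems D(3) by (subst cnot_commutator) (auto simp: D(4)[symmetric, simplified])
    ultimately show ?thesis using comp_in by metis
  qed
qed

text \<open>The gates \<open>f\<close> and \<open>h\<close> have \<open>n - 2\<close> controls each,
  the largest number that \<open>cnot_in\<close> allows. The positions \<open>f\<close> does not
  test are \<open>j\<close> and \<open>a\<close>, those \<open>h\<close> does not test are
  \<open>i\<close> and \<open>b\<close>. These pairs are disjoint, so a word moved by both gates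
  equals \<open>w\<close>. Four bits are needed to choose \<open>a\<close> and
  \<open>b\<close>.\<close>

lemma path_in:
  assumes w: "length w = n" and ij: "i < n" "j < n" "i \<noteq> j"
  shows "transpose w (bit_flip i w) \<circ> transpose w (bit_flip j w) \<in> K"
proof -
  have "card ({..<n} - {i, j}) \<ge> 2" using ij n_ge by (simp add: card_Diff_subset)
  then obtain a b where ab: "a < n" "b < n" "a \<noteq> b" "a \<notin> {i, j}" "b \<notin> {i, j}"
    by (auto simp: card_le_Suc_iff numeral_2_eq_2)
  define f where "f = cnot n ({..<n} - {j, a}) (\<lambda>k. w ! k) j"
  define h where "h = cnot n ({..<n} - {i, b}) (\<lambda>k. w ! k) i"
  have fh: "f w = bit_flip j w" "h w = bit_flip i w" using w by (simp_all add: f_def h_def cnot_def)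
  have "f \<circ> h \<circ> f \<circ> h = transpose w (h w) \<circ> transpose w (f w)"
  proof (rule commutator_single_overlap)
    show "f (f v) = v" "h (h v) = v" for v
      unfolding f_def h_def by (rule cnot_involution; auto)+
    show "f w \<noteq> w" "h w \<noteq> w" using bit_flip_neq ij w by (simp_all add: fh)
    fix v assume "f v \<noteq> v" "h v \<noteq> v"
    then have v: "length v = n" "\<forall>k\<in>{..<n} - {j, a}. v ! k = w ! k" "\<forall>k\<in>{..<n} - {i, b}. v ! k = w ! k"
      by (auto simp: f_def h_def cnot_def split: if_splits)
    show "v = w"
      by (rule nth_equalityI) (use v w ab ij in auto)
  qed
  moreover have "f \<in> K" "h \<in> K"
    unfolding f_def h_def using ij ab n_ge by (auto intro!: cnot_in simp: card_Diff_subset)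
  ultimately show ?thesis using comp_in by (metis fh)
qed

lemma even_permutation_in: "\<lbrakk>p permutes words n; evenperm p\<rbrakk> \<Longrightarrow> p \<in> K"
  by (rule even_permutations_from_paths[OF id_in comp_in path_in])

end

subsection \<open>Inert maps and their periodizations\<close>

lemma compact_UNIV_point: "compact (UNIV :: point set)"
proof -
  have "compact_space (euclidean :: bool topology)"
    by (simp add: compact_space_def compactin_euclidean_iff finite_imp_compact)
  then have "compact_space (product_topology (\<lambda>_::int. euclidean :: bool topology) UNIV)"
    by (simp add: compact_space_product_topology)
  then show ?thesis
    by (simp add: euclidean_product_topology compact_space_def compactin_euclidean_iff)
qed

lemma open_cylinder: "open {y :: point. \<forall>i. \<bar>i\<bar> \<le> N \<longrightarrow> y i = x i}"
proof -
  have "open {y :: point. \<forall>i\<in>{- N..N}. y (id i) \<in> {x i}}"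
    by (rule product_topology_basis') (auto intro: open_discrete)
  then show ?thesis by (simp add: abs_le_iff minus_le_iff Ball_def conj_commute)
qed

text \<open>The preimage of \<open>u x\<close> is open and so contains a basic box around
  \<open>x\<close>, which restricts only finitely many coordinates.\<close>

lemma continuous_bool_locally_constant:
  fixes u :: "point \<Rightarrow> bool"
  assumes "continuous_on UNIV u"
  shows "\<exists>N. \<forall>y. (\<forall>i. \<bar>i\<bar> \<le> N \<longrightarrow> y i = x i) \<longrightarrow> u y = u x"
proof -
  have "open (u -` {u x})" using assms by (intro open_vimage) (auto intro: open_discrete)
  then obtain U where U: "finite {i. U i \<noteq> UNIV}" "x \<in> Pi\<^sub>E UNIV U" "Pi\<^sub>E UNIV U \<subseteq> u -` {u x}"
    unfolding open_fun_def openin_product_topology_alt by force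
  define N where "N = Max (insert 0 (abs ` {i. U i \<noteq> UNIV}))"
  have "u y = u x" if y: "\<forall>i. \<bar>i\<bar> \<le> N \<longrightarrow> y i = x i" for y
  proof -
    have "y i \<in> U i" for i
    proof (cases "U i = UNIV")
      case False
      then have "\<bar>i\<bar> \<le> N" unfolding N_def using U(1) by (intro Max_ge) auto
      then have "y i = x i" using y by simp
      with U(2) show ?thesis by (auto simp: PiE_iff)
    qed simp
    then have "y \<in> Pi\<^sub>E UNIV U" by (simp add: PiE_iff)
    with U(3) show ?thesis by auto
  qed
  then show ?thesis by blast
qed

text \<open>Finitely many of the cylinders on which \<open>u\<close> is constant cover the compact
  space, and the largest of their radii works everywhere.\<close>

lemma continuous_bool_local:
  fixes u :: "point \<Rightarrow> bool"
  assumes "continuous_on UNIV u"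
  shows "\<exists>N. \<forall>x y. (\<forall>i. \<bar>i\<bar> \<le> N \<longrightarrow> x i = y i) \<longrightarrow> u x = u y"
proof -
  obtain N where N: "\<And>x y. (\<forall>i. \<bar>i\<bar> \<le> N x \<longrightarrow> y i = x i) \<Longrightarrow> u y = u x"
    using continuous_bool_locally_constant[OF assms] by metis
  define Z where "Z x = {y :: point. \<forall>i. \<bar>i\<bar> \<le> N x \<longrightarrow> y i = x i}" for x
  have "UNIV \<subseteq> (\<Union>x\<in>UNIV. Z x)" by (auto simp: Z_def)
  moreover have "open (Z x)" for x unfolding Z_def by (rule open_cylinder)
  ultimately obtain A where A: "finite A" "UNIV \<subseteq> (\<Union>x\<in>A. Z x)"
    using compactE_image[OF compact_UNIV_point, of UNIV Z] by metis
  define M where "M = Max (insert 0 (N ` A))"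
  have "u x = u y" if xy: "\<forall>i. \<bar>i\<bar> \<le> M \<longrightarrow> x i = y i" for x y
  proof -
    obtain a where a: "a \<in> A" "x \<in> Z a" using A(2) by blast
    have "N a \<le> M" unfolding M_def using A(1) a by (intro Max_ge) auto
    then have "\<forall>i. \<bar>i\<bar> \<le> N a \<longrightarrow> y i = a i" "\<forall>i. \<bar>i\<bar> \<le> N a \<longrightarrow> x i = a i"
      using xy a(2) by (auto simp: Z_def)
    then show ?thesis using N[of a x] N[of a y] by metis
  qed
  then show ?thesis by blast
qed

text \<open>The condition of \<open>strong_radius\<close> for an integer bound, with a dependence
  condition in place of a local rule, so that restricted words need not be handled.\<close>

definition local_on :: "(point \<Rightarrow> point) \<Rightarrow> int \<Rightarrow> bool" where
  "local_on g r \<longleftrightarrow> 0 \<le> r \<and> (\<forall>x i. r < \<bar>i\<bar> \<longrightarrow> g x i = x i) \<and>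
    (\<forall>x y i. (\<forall>j. \<bar>j\<bar> \<le> r \<longrightarrow> x j = y j) \<longrightarrow> \<bar>i\<bar> \<le> r \<longrightarrow> g x i = g y i)"

lemma local_onD:
  assumes "local_on g r"
  shows "0 \<le> r" "r < \<bar>i\<bar> \<Longrightarrow> g x i = x i"
    "(\<And>j. \<bar>j\<bar> \<le> r \<Longrightarrow> x j = y j) \<Longrightarrow> \<bar>i\<bar> \<le> r \<Longrightarrow> g x i = g y i"
  using assms by (auto simp: local_on_def)

text \<open>Positions between \<open>r\<close> and \<open>s\<close> are merely copied. This lets
  several maps share one radius.\<close>

lemma local_on_mono:
  assumes "local_on g r" "r \<le> s"
  shows "local_on g s"
  unfolding local_on_def
proof (intro conjI allI impI)
  fix x y :: point and i assume *: "\<forall>j. \<bar>j\<bar> \<le> s \<longrightarrow> x j = y j" "\<bar>i\<bar> \<le> s"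
  show "g x i = g y i"
  proof (cases "\<bar>i\<bar> \<le> r")
    case True
    show ?thesis by (rule local_onD(3)[OF assms(1) _ True]) (use * assms in auto)
  qed (use * local_onD(2)[OF assms(1), of i] in auto)
qed (use local_onD[OF assms(1)] assms(2) in auto)

text \<open>Only finitely many coordinates can change, and each is a continuous Boolean function of
  the point, hence depends on a finite window. One bound covers all these windows.\<close>

lemma inert_local:
  assumes "inert g"
  shows "\<exists>r. local_on g r"
proof -
  obtain r where r: "\<And>x i. r \<le> \<bar>i\<bar> \<Longrightarrow> g x i = x i" using assms by (auto simp: inert_def)
  have "continuous_on UNIV g"
    using assms by (auto simp: inert_def carrier_homeo_group homeomorphism_def)
  then have "\<exists>N. \<forall>x y. (\<forall>j. \<bar>j\<bar> \<le> N \<longrightarrow> x j = y j) \<longrightarrow> g x i = g y i" for i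
    by (rule continuous_bool_local[OF continuous_on_product_then_coordinatewise])
  then obtain N where N: "\<And>i x y. (\<forall>j. \<bar>j\<bar> \<le> N i \<longrightarrow> x j = y j) \<Longrightarrow> g x i = g y i"
    by metis
  define s where "s = Max (insert \<bar>r\<bar> (N ` {- r..r}))"
  have s: "\<bar>r\<bar> \<le> s" "\<And>i. \<bar>i\<bar> \<le> r \<Longrightarrow> N i \<le> s" unfolding s_def by (intro Max_ge; force)+
  have "local_on g s"
    unfolding local_on_def
  proof (intro conjI allI impI)
    fix x y :: point and i assume *: "\<forall>j. \<bar>j\<bar> \<le> s \<longrightarrow> x j = y j" "\<bar>i\<bar> \<le> s"
    show "g x i = g y i"
    proof (cases "\<bar>i\<bar> \<le> r")
      case True
      with s(2)[OF this] * show ?thesis by (intro N) auto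
    qed (use * r[of i] in auto)
  qed (use s r in auto)
  then show ?thesis ..
qed

section \<open>Periodization of inert maps\<close>

definition periodic :: "nat \<Rightarrow> point \<Rightarrow> bool" where
  "periodic n x \<longleftrightarrow> (\<forall>j k. x (j + k * int n) = x j)"

lemma periodicD: "periodic n x \<Longrightarrow> x (j + k * int n) = x j"
  by (simp add: periodic_def)

lemma mem_periodic_points: "x \<in> periodic_points n \<longleftrightarrow> periodic n x"
proof
  assume "x \<in> periodic_points n"
  then have x: "x (j + int n) = x j" for j
    by (simp add: periodic_points_def shift_funpow fun_eq_iff)
  have "x (j + k * int n) = x j" for j k
  proof (induction k rule: int_induct[where k = 0])
    case (step1 k)
    with x[of "j + k * int n"] show ?case by (simp add: algebra_simps)
  next
    case (step2 k)
    with x[of "j + (k - 1) * int n"] show ?case by (simp add: algebra_simps)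
  qed simp
  then show "periodic n x" by (simp add: periodic_def)
next
  assume x: "periodic n x"
  then show "x \<in> periodic_points n"
    using periodicD[OF x, of _ 1] by (simp add: periodic_points_def shift_funpow)
qed

text \<open>
  \<open>periodize n g\<close> is the limit of the products of conjugates of \<open>g\<close>. On periodic points it flips
  the coordinates that are flipped by some translate of \<open>g\<close>, and when the translates have disjoint
  supports at most one of them flips a given coordinate.
\<close>

definition periodize :: "nat \<Rightarrow> (point \<Rightarrow> point) \<Rightarrow> point \<Rightarrow> point" where
  "periodize n g x j = (x j \<noteq> (\<exists>k. g x (j + k * int n) \<noteq> x (j + k * int n)))"

text \<open>Distinct multiples of \<open>n\<close> are at least \<open>n\<close>, hence more than
  \<open>2 * r\<close>, apart.\<close>

lemma translates_disjoint:
  assumes "2 * r < int n" "\<bar>j - k * int n\<bar> \<le> r" "\<bar>j - l * int n\<bar> \<le> r"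
  shows "k = l"
proof (rule ccontr)
  assume "k \<noteq> l"
  then have "int n * 1 \<le> int n * \<bar>k - l\<bar>" by (intro mult_left_mono) auto
  also have "\<dots> = \<bar>k * int n - l * int n\<bar>" by (simp add: abs_mult left_diff_distrib[symmetric] mult.commute)
  finally show False using assms by linarith
qed

text \<open>Only the translate centred at \<open>k * n\<close> can change coordinate
  \<open>j\<close>, so the existential in \<open>periodize\<close> has \<open>- k\<close> as its
  only possible witness.\<close>

lemma periodize_near:
  assumes "local_on g r" "2 * r < int n" "periodic n x" "\<bar>j - k * int n\<bar> \<le> r"
  shows "periodize n g x j = g x (j - k * int n)"
proof -
  have x: "x (j + l * int n) = x j" for l using assms(3) by (rule periodicD)
  have "l = - k" if "g x (j + l * int n) \<noteq> x (j + l * int n)" for l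
  proof -
    have "\<bar>j + l * int n\<bar> \<le> r" using that local_onD(2)[OF assms(1), of "j + l * int n" x] by force
    then show ?thesis using translates_disjoint[OF assms(2,4), of "- l"] by simp
  qed
  then have "(\<exists>l. g x (j + l * int n) \<noteq> x (j + l * int n)) \<longleftrightarrow> g x (j + (- k) * int n) \<noteq> x (j + (- k) * int n)"
    by blast
  then show ?thesis unfolding periodize_def x by auto
qed

lemma periodize_far:
  assumes "local_on g r" "\<And>k. r < \<bar>j - k * int n\<bar>"
  shows "periodize n g x j = x j"
proof -
  have "g x (j + k * int n) = x (j + k * int n)" for k
    using local_onD(2)[OF assms(1)] assms(2)[of "- k"] by simp
  then show ?thesis by (simp add: periodize_def)
qed

lemma periodize_periodic: "periodic n x \<Longrightarrow> periodic n (periodize n g x)"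
proof -
  assume x: "periodic n x"
  have "(\<exists>l. g x (j + k * int n + l * int n) \<noteq> x (j + k * int n + l * int n))
      \<longleftrightarrow> (\<exists>l. g x (j + l * int n) \<noteq> x (j + l * int n))" (is "?L \<longleftrightarrow> ?R") for j k
  proof
    assume ?L
    then obtain l where "g x (j + k * int n + l * int n) \<noteq> x (j + k * int n + l * int n)" ..
    then show ?R by (intro exI[of _ "k + l"]) (simp add: algebra_simps)
  next
    assume ?R
    then obtain l where "g x (j + l * int n) \<noteq> x (j + l * int n)" ..
    then show ?L by (intro exI[of _ "l - k"]) (simp add: algebra_simps)
  qed
  then show ?thesis using periodicD[OF x] by (simp add: periodic_def periodize_def)
qed

text \<open>Induction on the list of factors. The windows are disjoint, so a new factor finds the
  original values of \<open>x\<close> in its own window and leaves the other windows alone.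
  Periodicity makes these values a translate of those around 0, so \<open>g\<close> may be applied
  to \<open>x\<close> itself.\<close>

lemma foldr_translates:
  assumes g: "local_on g r" and n: "2 * r < int n" and x: "periodic n x" and "distinct js"
  shows "(\<forall>i\<in>set js. \<forall>j. \<bar>j - i * int n\<bar> \<le> r \<longrightarrow>
      foldr (\<circ>) (map (\<lambda>i. shift_pow (- i * int n) \<circ> g \<circ> shift_pow (i * int n)) js) id x j
      = g x (j - i * int n)) \<and>
    (\<forall>j. (\<forall>i\<in>set js. r < \<bar>j - i * int n\<bar>) \<longrightarrow>
      foldr (\<circ>) (map (\<lambda>i. shift_pow (- i * int n) \<circ> g \<circ> shift_pow (i * int n)) js) id x j = x j)"
  using assms(4)
proof (induction js)
  case (Cons a js)
  define y where
    "y = foldr (\<circ>) (map (\<lambda>i. shift_pow (- i * int n) \<circ> g \<circ> shift_pow (i * int n)) js) id x"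
  have "distinct js" using Cons.prems by simp
  note IH = Cons.IH[OF this, folded y_def]
  have near: "y j = g x (j - i * int n)" if "i \<in> set js" "\<bar>j - i * int n\<bar> \<le> r" for i j
    using conjunct1[OF IH] that by blast
  have far: "y j = x j" if "\<forall>i\<in>set js. r < \<bar>j - i * int n\<bar>" for j
    using conjunct2[OF IH] that by blast
  define z where "z = g (\<lambda>j. y (j + a * int n))"
  have step: "foldr (\<circ>) (map (\<lambda>i. shift_pow (- i * int n) \<circ> g \<circ> shift_pow (i * int n)) (a # js)) id x
      = (\<lambda>j. z (j - a * int n))"
    by (simp add: y_def z_def shift_pow_eq)
  have out: "z (j - a * int n) = y j" if "r < \<bar>j - a * int n\<bar>" for j
    using local_onD(2)[OF g that] by (simp add: z_def)
  have "y (j + a * int n) = x j" if j: "\<bar>j\<bar> \<le> r" for j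
  proof -
    have "r < \<bar>j + a * int n - i * int n\<bar>" if "i \<in> set js" for i
      using translates_disjoint[OF n, of "j + a * int n" a i] j that Cons.prems by force
    then show ?thesis using far periodicD[OF x, of j a] by simp
  qed
  then have inside: "z (j - a * int n) = g x (j - a * int n)" if "\<bar>j - a * int n\<bar> \<le> r" for j
    unfolding z_def using local_onD(3)[OF g _ that, of "\<lambda>j. y (j + a * int n)" x] by simp
  show ?case
    unfolding step
  proof (intro conjI ballI allI impI)
    fix i j assume i: "i \<in> set (a # js)" and j: "\<bar>j - i * int n\<bar> \<le> r"
    show "z (j - a * int n) = g x (j - i * int n)"
    proof (cases "i = a")
      case False
      then have "r < \<bar>j - a * int n\<bar>" using translates_disjoint[OF n j, of a] by force
      with out near[of i j] False i j show ?thesis by simp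
    qed (use inside j in simp)
  next
    fix j assume "\<forall>i\<in>set (a # js). r < \<bar>j - i * int n\<bar>"
    with out far show "z (j - a * int n) = x j" by simp
  qed
qed simp

lemma tendsto_point:
  fixes f :: "nat \<Rightarrow> point"
  assumes "\<And>j. (\<lambda>k. f k j) \<longlonglongrightarrow> l j"
  shows "f \<longlonglongrightarrow> l"
proof -
  have "limitin (product_topology (\<lambda>_. euclidean) UNIV) f l sequentially"
    unfolding limitin_componentwise using assms by simp
  then show ?thesis by (simp add: euclidean_product_topology)
qed

text \<open>Every coordinate is eventually constant: one within \<open>r\<close> of
  \<open>i * n\<close> is settled once \<open>k\<close> reaches \<open>\<bar>i\<bar>\<close>, and
  one that is near no multiple of \<open>n\<close> never changes.\<close>

lemma periodized_lim:
  assumes g: "local_on g r" and n: "2 * r < int n" and x: "periodic n x"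
  shows "lim (\<lambda>k. periodized g n k x) = periodize n g x"
proof -
  have "(\<lambda>k. periodized g n k x) \<longlonglongrightarrow> periodize n g x"
  proof (rule tendsto_point, rule tendsto_eventually)
    fix j
    have r: "0 \<le> r" using local_onD(1)[OF g] .
    note f = foldr_translates[OF g n x, of "[- int k..int k]" for k, folded periodized_def, simplified]
    show "\<forall>\<^sub>F k in sequentially. periodized g n k x j = periodize n g x j"
    proof (cases "\<exists>i. \<bar>j - i * int n\<bar> \<le> r")
      case True
      then obtain i where i: "\<bar>j - i * int n\<bar> \<le> r" by auto
      show ?thesis
        using eventually_ge_at_top[of "nat \<bar>i\<bar>"]
      proof eventually_elim
        case (elim k)
        then have "i \<in> {- int k..int k}" by auto
        with conjunct1[OF f[of k]] i have "periodized g n k x j = g x (j - i * int n)" by blast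
        then show ?case using periodize_near[OF g n x i] by simp
      qed
    next
      case False
      then have "r < \<bar>j - i * int n\<bar>" for i by (simp add: not_le)
      then show ?thesis using f periodize_far[OF g, of j n x] by simp
    qed
  qed
  then show ?thesis by (rule limI)
qed

lemma local_on_comp:
  assumes "local_on g r" "local_on h r"
  shows "local_on (g \<circ> h) r"
  unfolding local_on_def
proof (intro conjI allI impI)
  fix x y :: point and i assume *: "\<forall>j. \<bar>j\<bar> \<le> r \<longrightarrow> x j = y j" "\<bar>i\<bar> \<le> r"
  have "h x j = h y j" if "\<bar>j\<bar> \<le> r" for j
    by (rule local_onD(3)[OF assms(2) _ that]) (use * in auto)
  then show "(g \<circ> h) x i = (g \<circ> h) y i"
    using local_onD(3)[OF assms(1) _ *(2), of "h x" "h y"] by simp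
qed (use local_onD(1,2)[OF assms(1)] local_onD(2)[OF assms(2)] in auto)

text \<open>Within distance \<open>r\<close> of 0, \<open>periodize n h x\<close> agrees with
  \<open>h x\<close>, and this is all that \<open>g\<close> reads. Coordinates outside all windows
  are left alone by both sides.\<close>

lemma periodize_comp:
  assumes g: "local_on g r" and h: "local_on h r" and n: "2 * r < int n" and x: "periodic n x"
  shows "periodize n (g \<circ> h) x = periodize n g (periodize n h x)"
proof
  fix j
  let ?y = "periodize n h x"
  have y: "periodic n ?y" using x by (rule periodize_periodic)
  show "periodize n (g \<circ> h) x j = periodize n g ?y j"
  proof (cases "\<exists>k. \<bar>j - k * int n\<bar> \<le> r")
    case True
    then obtain k where k: "\<bar>j - k * int n\<bar> \<le> r" ..
    have "?y i = h x i" if "\<bar>i\<bar> \<le> r" for i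
      using periodize_near[OF h n x, of i 0] that by simp
    then have "g ?y (j - k * int n) = g (h x) (j - k * int n)"
      by (rule local_onD(3)[OF g _ k])
    then show ?thesis
      using periodize_near[OF local_on_comp[OF g h] n x k] periodize_near[OF g n y k] by simp
  next
    case False
    then have "r < \<bar>j - k * int n\<bar>" for k by (simp add: not_le)
    then show ?thesis
      using periodize_far[OF local_on_comp[OF g h]] periodize_far[OF g] periodize_far[OF h] by simp
  qed
qed

lemma periodize_conj:
  "periodize n (shift_pow (- b) \<circ> g \<circ> shift_pow b) x = shift_pow (- b) (periodize n g (shift_pow b x))"
  by (simp add: periodize_def shift_pow_eq fun_eq_iff algebra_simps)

lemma periodize_id [simp]: "periodize n id x = x"
  by (simp add: periodize_def fun_eq_iff)

lemma periodic_shift_pow: "periodic n x \<Longrightarrow> periodic n (shift_pow m x)"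
proof -
  assume x: "periodic n x"
  have "x (j + k * int n + m) = x (j + m)" for j k
    using periodicD[OF x, of "j + m" k] by (simp add: algebra_simps)
  then show ?thesis by (simp add: periodic_def shift_pow_eq)
qed

section \<open>Word maps and their composition\<close>

lemma periodic_extension_restrict:
  assumes "periodic n x" "0 < n"
  shows "periodic_extension (map (\<lambda>i. x (int i)) [0..<n]) = x"
proof
  fix j
  have "0 \<le> j mod int n" "j mod int n < int n" using assms(2) by simp_all
  then have "periodic_extension (map (\<lambda>i. x (int i)) [0..<n]) j = x (j mod int n)"
    using assms(2) by (simp add: periodic_extension_def nat_less_iff)
  also have "j mod int n = j + (- (j div int n)) * int n"
    by (simp add: minus_div_mult_eq_mod[symmetric])
  also have "x \<dots> = x j" by (rule periodicD[OF assms(1)])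
  finally show "periodic_extension (map (\<lambda>i. x (int i)) [0..<n]) j = x j" .
qed

lemma periodic_periodic_extension: "length w = n \<Longrightarrow> periodic n (periodic_extension w)"
  using periodic_extension_periodic[of w] by (simp add: mem_periodic_points)

text \<open>A closed form for the word map, free of limits and definite descriptions, on which all
  later computations rest.\<close>

lemma word_map_eq:
  assumes "inert g" "local_on g r" "2 * r < int n" "length w = n"
  shows "word_map n (shift_pow m \<circ> g) w
    = map (\<lambda>i. shift_pow m (periodize n g (periodic_extension w)) (int i)) [0..<n]"
  using assms periodized_lim[OF assms(2,3) periodic_periodic_extension[OF assms(4)]]
  by (simp add: word_map_def periodic_action_def shift_inert_decomposition mem_periodic_points
      periodic_periodic_extension)

lemma periodic_extension_word_map:
  assumes "inert g" "local_on g r" "2 * r < int n" "length w = n"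
  shows "periodic_extension (word_map n (shift_pow m \<circ> g) w)
    = shift_pow m (periodize n g (periodic_extension w))"
proof -
  have "0 < n" using local_onD(1)[OF assms(2)] assms(3) by simp
  then show ?thesis
    unfolding word_map_eq[OF assms]
    by (intro periodic_extension_restrict periodic_shift_pow periodize_periodic
        periodic_periodic_extension assms(4))
qed

lemma length_word_map [simp]: "length (word_map n f w) = length w"
  by (simp add: word_map_def)

lemma word_map_outside: "length w \<noteq> n \<Longrightarrow> word_map n f w = w"
  by (simp add: word_map_def)

lemma eventually_large: "\<forall>\<^sub>F n in sequentially. r < int n"
  using eventually_gt_at_top[of "nat r"] by eventually_elim auto

text \<open>Moving the inner shift to the left replaces \<open>g\<close> by its conjugate
  \<open>?c\<close>, which gives the decomposition of the product. For \<open>n\<close> beyond twice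
  a common radius of \<open>g\<close>, \<open>g'\<close> and \<open>?c\<close>, the periodization
  splits over the composition and respects the conjugation.\<close>

lemma word_map_comp:
  assumes "f \<in> shift_inert_group" "h \<in> shift_inert_group"
  shows "\<forall>\<^sub>F n in sequentially. word_map n (f \<circ> h) = word_map n f \<circ> word_map n h"
proof -
  obtain a g b g' where f: "f = shift_pow a \<circ> g" "inert g" and h: "h = shift_pow b \<circ> g'" "inert g'"
    using assms shift_inert_group_decomposition by metis
  let ?c = "shift_pow (- b) \<circ> g \<circ> shift_pow b"
  have c: "inert ?c" by (rule inert_conj) (rule f)
  obtain r s t where "local_on g r" "local_on g' s" "local_on ?c t"
    using inert_local f h c by metis
  then obtain r where r: "local_on g r" "local_on g' r" "local_on ?c r"
    using local_on_mono[of _ _ "max r (max s t)"] by (metis max.cobounded1 max.cobounded2 max.coboundedI2)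
  have fh: "f \<circ> h = shift_pow (a + b) \<circ> (?c \<circ> g')"
    by (auto simp: f(1) h(1) shift_pow_eq fun_eq_iff)
  show ?thesis
    using eventually_large[of "2 * r"]
  proof eventually_elim
    case (elim n)
    show ?case
    proof
      fix w
      show "word_map n (f \<circ> h) w = (word_map n f \<circ> word_map n h) w"
      proof (cases "length w = n")
        case True
        let ?x = "periodic_extension w"
        have x: "periodic n ?x" using True by (rule periodic_periodic_extension)
        have "shift_pow (a + b) (periodize n (?c \<circ> g') ?x)
            = shift_pow a (periodize n g (shift_pow b (periodize n g' ?x)))"
          unfolding periodize_comp[OF r(3,2) elim x] periodize_conj
          by (simp add: shift_pow_eq fun_eq_iff add.assoc)
        also have "shift_pow b (periodize n g' ?x) = periodic_extension (word_map n h w)"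
          unfolding h(1) by (rule periodic_extension_word_map[OF h(2) r(2) elim True, symmetric])
        finally have "shift_pow (a + b) (periodize n (?c \<circ> g') ?x)
            = shift_pow a (periodize n g (periodic_extension (word_map n h w)))" .
        then show ?thesis
          unfolding fh comp_apply[of "word_map n f"]
            word_map_eq[OF inert_comp[OF c h(2)] local_on_comp[OF r(3,2)] elim True]
          unfolding f(1) using True by (subst word_map_eq[OF f(2) r(1) elim]) simp_all
      qed (simp add: word_map_outside)
    qed
  qed
qed

lemma word_map_inert:
  assumes "inert g" "local_on g r" "2 * r < int n" "length w = n"
  shows "word_map n g w = map (\<lambda>i. periodize n g (periodic_extension w) (int i)) [0..<n]"
  using word_map_eq[OF assms, of 0] by (simp add: shift_pow_zero)

lemma local_on_id: "local_on id 0"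
  by (simp add: local_on_def)

lemma word_map_id:
  assumes "0 < n"
  shows "word_map n id = id"
proof
  fix w show "word_map n id w = id w"
    using assms word_map_inert[OF inert_id local_on_id, of n w] word_map_outside[of w n id]
    by (cases "length w = n") (auto intro!: nth_equalityI simp: periodic_extension_nth)
qed

lemma word_map_shift_eq:
  assumes "0 < n"
  shows "word_map n shift = bit_perm n (rot n)"
proof (rule word_fun_eqI[where n = n])
  fix w :: "bool list" and i assume w: "length w = n" and i: "i < n"
  have "word_map n (shift_pow 1 \<circ> id) w ! i = periodic_extension w (int i + 1)"
    using word_map_eq[OF inert_id local_on_id _ w, of 1] assms i by (simp add: shift_pow_eq)
  also have "\<dots> = bit_perm n (rot n) w ! i"
  proof (cases "Suc i = n")
    case True
    then have "int i + 1 = int (length w)" using w by simp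
    then have "periodic_extension w (int i + 1) = w ! 0"
      by (simp only: periodic_extension_def mod_self nat_0)
    then show ?thesis using w i True by (simp add: nth_bit_perm rot_def)
  next
    case False
    then show ?thesis
      using w i periodic_extension_nth[of "Suc i" w] by (simp add: nth_bit_perm rot_def add.commute)
  qed
  finally show "word_map n shift w ! i = bit_perm n (rot n) w ! i"
    by (simp only: shift_pow_one o_id)
qed (simp_all add: word_map_outside bit_perm_outside)

section \<open>Swap, negation and Toffoli gate as inert maps\<close>

text \<open>The three explicit gates all have this shape, so inertness and word maps can be computed
  once for all of them.\<close>

definition flip_if :: "int set \<Rightarrow> (point \<Rightarrow> bool) \<Rightarrow> point \<Rightarrow> point" where
  "flip_if A P x = (\<lambda>i. x i \<noteq> (i \<in> A \<and> P x))"

lemma local_bool_continuous: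
  fixes u :: "point \<Rightarrow> bool"
  assumes "\<And>x y. (\<forall>i. \<bar>i\<bar> \<le> N \<longrightarrow> y i = x i) \<Longrightarrow> u y = u x"
  shows "continuous_on UNIV u"
proof -
  have "open (u -` B)" for B
  proof (subst open_subopen, intro ballI)
    fix x assume x: "x \<in> u -` B"
    let ?T = "{y :: point. \<forall>i. \<bar>i\<bar> \<le> N \<longrightarrow> y i = x i}"
    have "?T \<subseteq> u -` B"
    proof
      fix y assume "y \<in> ?T"
      then have "u y = u x" by (intro assms) simp
      with x show "y \<in> u -` B" by simp
    qed
    moreover have "x \<in> ?T" by simp
    ultimately show "\<exists>T. open T \<and> x \<in> T \<and> T \<subseteq> u -` B"
      using open_cylinder[of N x] by blast
  qed
  then show ?thesis by (simp add: continuous_on_open_vimage)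
qed

text \<open>Finite dependence makes every coordinate continuous, and an involution is its own
  continuous inverse.\<close>

lemma inert_local_involution:
  assumes "local_on g r" "\<And>x. g (g x) = x"
  shows "inert g"
proof -
  have "continuous_on UNIV (\<lambda>x. g x i)" for i
  proof (rule local_bool_continuous)
    \<comment> \<open>The window must contain \<open>i\<close> itself, because a coordinate beyond
      \<open>r\<close> is copied from the input.\<close>
    fix x y :: point assume *: "\<forall>j. \<bar>j\<bar> \<le> max r \<bar>i\<bar> \<longrightarrow> y j = x j"
    show "g y i = g x i"
      by (rule local_onD(3)[OF local_on_mono[OF assms(1), of "max r \<bar>i\<bar>"]]) (use * in auto)
  qed
  then have "continuous_on UNIV g" by (rule continuous_on_coordinatewise_then_product)
  moreover have "surj g" using assms(2) by (metis surjI)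
  ultimately have "homeomorphism UNIV UNIV g g" using assms(2) by (simp add: homeomorphism_def)
  moreover have "\<forall>x i. r + 1 \<le> \<bar>i\<bar> \<longrightarrow> g x i = x i" using local_onD(2)[OF assms(1)] by simp
  ultimately show ?thesis unfolding inert_def carrier_homeo_group by blast
qed

lemma flip_if_gate:
  assumes A: "A \<subseteq> {0..2}" and P: "\<And>x. P (flip_if A P x) = P x"
    and loc: "\<And>x y. (\<forall>i\<in>{0..2}. x i = y i) \<Longrightarrow> P x = P y"
  shows "inert (flip_if A P)"
    and "\<And>n w i. \<lbrakk>4 < n; length w = n; i < n\<rbrakk> \<Longrightarrow>
      word_map n (flip_if A P) w ! i = (w ! i \<noteq> (int i \<in> A \<and> P (periodic_extension w)))"
proof -
  have l: "local_on (flip_if A P) 2"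
    unfolding local_on_def
  proof (intro conjI allI impI)
    fix x y :: point and i :: int assume *: "\<forall>j. \<bar>j\<bar> \<le> 2 \<longrightarrow> x j = y j" "\<bar>i\<bar> \<le> 2"
    then have "P x = P y" by (intro loc) auto
    with * show "flip_if A P x i = flip_if A P y i" by (simp add: flip_if_def)
  qed (use A in \<open>auto simp: flip_if_def\<close>)
  have "flip_if A P (flip_if A P x) i = x i" for x i
    by (subst flip_if_def, subst P) (auto simp: flip_if_def)
  then have inv: "flip_if A P (flip_if A P x) = x" for x by (rule ext)
  from l inv show inert: "inert (flip_if A P)" by (rule inert_local_involution)
  fix n i :: nat and w :: "bool list" assume n: "4 < n" and w: "length w = n" and i: "i < n"
  \<comment> \<open>As \<open>A\<close> lies in \<open>{0..2}\<close> and \<open>i\<close> in the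
    base period, only the untranslated copy of the gate can act at \<open>i\<close>.\<close>
  have "k = 0" if "int i + k * int n \<in> A" for k
  proof (rule ccontr)
    assume "k \<noteq> 0"
    then consider "k \<le> - 1" | "1 \<le> k" by linarith
    then have "k * int n \<le> - 1 * int n \<or> 1 * int n \<le> k * int n"
      using mult_right_mono[of k "- 1" "int n"] mult_right_mono[of 1 k "int n"] by cases auto
    moreover have "0 \<le> int i + k * int n" "int i + k * int n \<le> 2" using that A by auto
    ultimately show False using n i by (elim disjE) linarith+
  qed
  then have "(\<exists>k. int i + k * int n \<in> A) \<longleftrightarrow> int i \<in> A"
    by (metis add.right_neutral mult_zero_left)
  then show "word_map n (flip_if A P) w ! i = (w ! i \<noteq> (int i \<in> A \<and> P (periodic_extension w)))"
    using word_map_inert[OF inert l _ w] n w i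
    by (auto simp: periodize_def flip_if_def periodic_extension_nth)
qed

text \<open>Exchanging two bits amounts to flipping both when they differ, a condition that the
  exchange preserves.\<close>

lemma swap_gate:
  defines "g \<equiv> flip_if {0, 1} (\<lambda>x. x 0 \<noteq> x 1)"
  shows "inert g" "4 < n \<Longrightarrow> word_map n g = bit_perm n (transpose 0 1)"
proof -
  have *: "{0, 1} \<subseteq> {0..2::int}"
    "(flip_if {0, 1} (\<lambda>x. x 0 \<noteq> x 1) x 0 \<noteq> flip_if {0, 1} (\<lambda>x. x 0 \<noteq> x 1) x 1) = (x 0 \<noteq> x 1)"
    "(\<forall>i\<in>{0..2}. x i = y i) \<Longrightarrow> (x 0 \<noteq> x 1) = (y 0 \<noteq> y 1)" for x y :: point
    by (auto simp: flip_if_def)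
  show "inert g" unfolding g_def by (rule flip_if_gate(1)[where A = "{0, 1}" and P = "\<lambda>x. x 0 \<noteq> x 1", OF *])
  assume n: "4 < n"
  show "word_map n g = bit_perm n (transpose 0 1)"
  proof (rule word_fun_eqI[where n = n])
    fix w :: "bool list" and i assume w: "length w = n" and i: "i < n"
    have "periodic_extension w 0 = w ! 0" "periodic_extension w 1 = w ! 1"
      using periodic_extension_nth[of 0 w] periodic_extension_nth[of 1 w] w n by auto
    moreover have "word_map n g w ! i = (w ! i \<noteq> (int i \<in> {0, 1} \<and> (periodic_extension w 0 \<noteq> periodic_extension w 1)))"
      unfolding g_def by (rule flip_if_gate(2)[where A = "{0, 1}" and P = "\<lambda>x. x 0 \<noteq> x 1", OF * n w i])
    ultimately show "word_map n g w ! i = bit_perm n (transpose 0 1) w ! i"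
      using w i n
      by (auto simp: nth_bit_perm transpose_def)
  qed (simp_all add: word_map_outside bit_perm_outside)
qed

lemma not_gate:
  defines "g \<equiv> flip_if {0} (\<lambda>_. True)"
  shows "inert g" "4 < n \<Longrightarrow> word_map n g = cnot n {} (\<lambda>_. True) 0"
proof -
  show "inert g" unfolding g_def by (rule flip_if_gate(1)[where P = "\<lambda>_. True"]) auto
  assume n: "4 < n"
  show "word_map n g = cnot n {} (\<lambda>_. True) 0"
  proof (rule word_fun_eqI[where n = n])
    fix w :: "bool list" and i assume w: "length w = n" and i: "i < n"
    have "word_map n g w ! i = (w ! i \<noteq> (int i \<in> {0} \<and> True))"
      unfolding g_def by (rule flip_if_gate(2)[where P = "\<lambda>_. True"]) (use n w i in auto)
    then show "word_map n g w ! i = cnot n {} (\<lambda>_. True) 0 w ! i"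
      using w i by (auto simp: nth_cnot)
  qed (simp_all add: word_map_outside cnot_outside)
qed

lemma toffoli_gate:
  defines "g \<equiv> flip_if {2} (\<lambda>x. x 0 \<and> x 1)"
  shows "inert g" "4 < n \<Longrightarrow> word_map n g = cnot n {0, 1} (\<lambda>_. True) 2"
proof -
  have *: "{2} \<subseteq> {0..2::int}"
    "(flip_if {2} (\<lambda>x. x 0 \<and> x 1) x 0 \<and> flip_if {2} (\<lambda>x. x 0 \<and> x 1) x 1) = (x 0 \<and> x 1)"
    "(\<forall>i\<in>{0..2}. x i = y i) \<Longrightarrow> (x 0 \<and> x 1) = (y 0 \<and> y 1)" for x y :: point
    by (auto simp: flip_if_def)
  show "inert g" unfolding g_def by (rule flip_if_gate(1)[where A = "{2}" and P = "\<lambda>x. x 0 \<and> x 1", OF *])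
  assume n: "4 < n"
  show "word_map n g = cnot n {0, 1} (\<lambda>_. True) 2"
  proof (rule word_fun_eqI[where n = n])
    fix w :: "bool list" and i assume w: "length w = n" and i: "i < n"
    have "periodic_extension w 0 = w ! 0" "periodic_extension w 1 = w ! 1"
      using periodic_extension_nth[of 0 w] periodic_extension_nth[of 1 w] w n by auto
    moreover have "word_map n g w ! i = (w ! i \<noteq> (int i \<in> {2} \<and> (periodic_extension w 0 \<and> periodic_extension w 1)))"
      unfolding g_def by (rule flip_if_gate(2)[where A = "{2}" and P = "\<lambda>x. x 0 \<and> x 1", OF * n w i])
    ultimately show "word_map n g w ! i = cnot n {0, 1} (\<lambda>_. True) 2 w ! i"
      using w i by (auto simp: nth_cnot)
  qed (simp_all add: word_map_outside cnot_outside)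
qed

subsection \<open>Parity\<close>

text \<open>For \<open>b = w ! j\<close> the update leaves \<open>w\<close> alone, so
  \<open>p w\<close> must already carry this value at \<open>j\<close>.\<close>

lemma bit_update_permutes_eq:
  assumes "\<And>w b. length w = n \<Longrightarrow> p (w[j := b]) = (p w)[j := b]"
    and "length w = n" "length (p w) = n" "j < n"
  shows "p w ! j = w ! j"
  using assms(1)[OF assms(2), of "w ! j"] assms by (metis list_update_id nth_list_update_eq)

text \<open>
  The permutation splits into its actions on the words with bit \<open>j\<close> equal to 0 and 1, and these are
  conjugate under flipping bit \<open>j\<close>.
\<close>

lemma evenperm_independent_bit:
  assumes p: "p permutes words n" and j: "j < n"
    and upd: "\<And>w b. length w = n \<Longrightarrow> p (w[j := b]) = (p w)[j := b]"
  shows "evenperm p"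
proof -
  have len: "length (p w) = n" if "length w = n" for w
    using permutes_in_image[OF p, of w] that by (simp add: words_def)
  have out: "p w = w" if "length w \<noteq> n" for w
    using permutes_not_in[OF p, of w] that by (simp add: words_def)
  have bit: "p w ! j = w ! j" if "length w = n" for w
    by (rule bit_update_permutes_eq[where n = n, OF upd that len[OF that] j])
  define f where "f w = (if length w = n then bit_flip j w else w)" for w
  have ff: "f (f w) = w" for w by (simp add: f_def)
  have flip: "p (bit_flip j w) = bit_flip j (p w)" if "length w = n" for w
    unfolding bit_flip_def upd[OF that] bit[OF that] ..
  define q where "q w = (if length w = n \<and> \<not> w ! j then p w else w)" for w
  have "inj_on q (words n)"
  proof (rule inj_onI)
    fix v w assume *: "v \<in> words n" "w \<in> words n" "q v = q w"
    then have l: "length v = n" "length w = n" by (simp_all add: words_def)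
    have "q u ! j = u ! j" if "length u = n" for u
      using bit[OF that] by (simp add: q_def)
    then have "v ! j = w ! j" using l * by metis
    with * l permutes_inj[OF p] show "v = w" by (auto simp: q_def inj_eq split: if_splits)
  qed
  moreover from this have "q ` words n = words n"
    by (intro endo_inj_surj[OF finite_words]) (use len in \<open>auto simp: q_def words_def\<close>)
  ultimately have "q permutes words n"
    by (intro bij_imp_permutes bij_betw_imageI) (simp_all add: q_def words_def)
  then have q: "permutation q" by (rule permutes_imp_permutation[OF finite_words])
  have "f permutes words n"
    by (rule permutes_by_inverse[of f f]) (auto simp: ff fun_eq_iff f_def words_def)
  then have f: "permutation f" by (rule permutes_imp_permutation[OF finite_words])
  have "p = q \<circ> (f \<circ> q \<circ> f)"
  proof
    fix w show "p w = (q \<circ> (f \<circ> q \<circ> f)) w"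
    proof (cases "length w = n")
      case True
      have "bit_flip j w ! j \<longleftrightarrow> \<not> w ! j" using j True by (simp add: nth_bit_flip)
      then show ?thesis using True by (simp add: q_def f_def flip bit len)
    qed (simp add: q_def f_def out)
  qed
  moreover have "evenperm (q \<circ> (f \<circ> q \<circ> f))"
    using q f by (auto simp: evenperm_comp permutation_compose)
  ultimately show ?thesis by simp
qed

lemma evenperm_bit_perm:
  assumes "\<pi> permutes {..<n}" "3 \<le> n"
  shows "evenperm (bit_perm n \<pi>)"
  using assms(1) finite_lessThan
proof (induction \<pi> rule: permutes_induct)
  case (swap a b \<pi>)
  have t: "transpose a b permutes {..<n}" using swap by (intro permutes_swap_id)
  \<comment> \<open>With \<open>3 \<le> n\<close> some position is fixed by the swap; the swap
    commutes with writing a bit there, so it is even.\<close>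
  obtain j where j: "j < n" "j \<noteq> a" "j \<noteq> b"
  proof -
    have "card {a, b} < card {..<n}" using assms(2) by (simp add: card_insert_if)
    then have "\<not> {..<n} \<subseteq> {a, b}" by (metis card_mono finite.emptyI finite.insertI not_le)
    then show ?thesis using that by auto
  qed
  have "evenperm (bit_perm n (transpose a b))"
  proof (rule evenperm_independent_bit[OF bit_perm_permutes(1)[OF t] j(1)])
    fix w :: "bool list" and c assume w: "length w = n"
    have lt: "transpose a b i < n" if "i < n" for i
      using that swap(1,2) by (simp add: transpose_def)
    have tj: "j = transpose a b i \<longleftrightarrow> j = i" for i using j by (auto simp: transpose_def)
    show "bit_perm n (transpose a b) (w[j := c]) = (bit_perm n (transpose a b) w)[j := c]"
      by (rule nth_equalityI) (use w lt tj j(1) in \<open>auto simp: nth_bit_perm nth_list_update\<close>)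
  qed
  moreover have "bit_perm n (transpose a b \<circ> \<pi>) = bit_perm n \<pi> \<circ> bit_perm n (transpose a b)"
    using bit_perm_comp[of \<pi> n "transpose a b"] swap by simp
  moreover have "permutation (bit_perm n \<pi>)" "permutation (bit_perm n (transpose a b))"
    using swap t by (auto intro: permutes_imp_permutation[OF finite_words] bit_perm_permutes(1))
  ultimately show ?case using swap by (simp only: evenperm_comp)
qed (simp only: bit_perm_id evenperm_id)

subsection \<open>Word maps of large length\<close>

lemma group_word_sym_group: "group (word_sym_group n)"
proof (rule groupI)
  fix p assume "p \<in> carrier (word_sym_group n)"
  then have "inv_into UNIV p \<in> carrier (word_sym_group n) \<and>
      inv_into UNIV p \<otimes>\<^bsub>word_sym_group n\<^esub> p = \<one>\<^bsub>word_sym_group n\<^esub>"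
    by (simp add: word_sym_group_def permutes_inv permutes_inv_o)
  then show "\<exists>q\<in>carrier (word_sym_group n). q \<otimes>\<^bsub>word_sym_group n\<^esub> p = \<one>\<^bsub>word_sym_group n\<^esub>"
    by blast
qed (auto simp: word_sym_group_def permutes_compose permutes_id comp_assoc)

lemma word_sym_group_simps:
  "carrier (word_sym_group n) = {p. p permutes words n}"
  "p \<otimes>\<^bsub>word_sym_group n\<^esub> q = p \<circ> q" "\<one>\<^bsub>word_sym_group n\<^esub> = id"
  by (simp_all add: word_sym_group_def)

lemma inv_word_sym_group:
  assumes "p permutes words n"
  shows "inv\<^bsub>word_sym_group n\<^esub> p = inv_into UNIV p"
  using assms
  by (intro group.inv_equality[OF group_word_sym_group])
    (simp_all only: word_sym_group_simps mem_Collect_eq permutes_inv permutes_inv_o)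

lemma word_alt_permutation: "p \<in> word_alt n \<Longrightarrow> permutation p"
  by (auto simp: word_alt_def intro: permutes_imp_permutation[OF finite_words])

lemma word_alt_comp: "\<lbrakk>p \<in> word_alt n; q \<in> word_alt n\<rbrakk> \<Longrightarrow> p \<circ> q \<in> word_alt n"
  using word_alt_permutation[of p n] word_alt_permutation[of q n]
  by (simp add: word_alt_def permutes_compose evenperm_comp)

lemma word_alt_inv: "p \<in> word_alt n \<Longrightarrow> inv_into UNIV p \<in> word_alt n"
  using word_alt_permutation[of p n]
  by (simp add: word_alt_def permutes_inv evenperm_inv)

lemma subgroup_word_alt: "subgroup (word_alt n) (word_sym_group n)"
proof (rule group.subgroupI[OF group_word_sym_group])
  show "word_alt n \<noteq> {}"
    using permutes_id evenperm_id unfolding word_alt_def by blast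
  fix p q assume p: "p \<in> word_alt n"
  then have "inv\<^bsub>word_sym_group n\<^esub> p = inv_into UNIV p"
    by (intro inv_word_sym_group) (simp add: word_alt_def)
  with word_alt_inv[OF p] show "inv\<^bsub>word_sym_group n\<^esub> p \<in> word_alt n" by simp
  assume "q \<in> word_alt n"
  with word_alt_comp[OF p] show "p \<otimes>\<^bsub>word_sym_group n\<^esub> q \<in> word_alt n"
    unfolding word_sym_group_simps .
qed (auto simp: word_alt_def word_sym_group_simps)

section \<open>From the group G to permutations of words\<close>

lemma shift_inert_group_subgroup: "subgroup shift_inert_group homeo_group"
  unfolding shift_inert_group_def
  by (rule homeo.generate_is_subgroup) (auto simp: inert_def)

lemma shift_inert_groupI:
  "shift \<in> shift_inert_group" "inert g \<Longrightarrow> g \<in> shift_inert_group"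
  unfolding shift_inert_group_def by (auto intro: generate.incl)

text \<open>Applying \<open>word_map_comp\<close> to \<open>f\<close> and its inverse in both orders
  shows that their word maps are mutually inverse for large \<open>n\<close>.\<close>

lemma word_map_permutes:
  assumes "f \<in> shift_inert_group"
  shows "\<forall>\<^sub>F n in sequentially.
    word_map n f permutes words n \<and>
    word_map n (inv\<^bsub>homeo_group\<^esub> f) = inv_into UNIV (word_map n f)"
proof -
  let ?f' = "inv\<^bsub>homeo_group\<^esub> f"
  have f': "?f' \<in> shift_inert_group"
    by (rule subgroup.m_inv_closed[OF shift_inert_group_subgroup assms])
  have "f \<in> carrier homeo_group"
    by (rule subgroup.mem_carrier[OF shift_inert_group_subgroup assms])
  then have id: "f \<circ> ?f' = id" "?f' \<circ> f = id"
    using homeo.r_inv homeo.l_inv by (simp_all only: homeo_group_simps)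
  show ?thesis
    using word_map_comp[OF assms f'] word_map_comp[OF f' assms] eventually_gt_at_top[of 0]
  proof eventually_elim
    case (elim n)
    then have *: "word_map n f \<circ> word_map n ?f' = id" "word_map n ?f' \<circ> word_map n f = id"
      unfolding id word_map_id[OF elim(3)] by simp_all
    then have "word_map n f permutes words n"
      by (rule permutes_by_inverse) (simp add: words_def word_map_outside)
    moreover have "word_map n ?f' = inv_into UNIV (word_map n f)"
      using inv_unique_comp[OF *] by simp
    ultimately show ?case by simp
  qed
qed

text \<open>Some bit of a long word lies outside all windows, so the word map neither reads nor
  changes it and \<open>evenperm_independent_bit\<close> applies.\<close>

lemma word_map_inert_even:
  assumes g: "inert g"
  shows "\<forall>\<^sub>F n in sequentially. word_map n g \<in> word_alt n"
proof -
  obtain r where r: "local_on g r" using inert_local[OF g] ..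
  show ?thesis
    using word_map_permutes[OF shift_inert_groupI(2)[OF g]] eventually_large[of "2 * r + 1"]
  proof eventually_elim
    case (elim n)
    have r0: "0 \<le> r" using local_onD(1)[OF r] .
    have n: "2 * r < int n" using elim(2) by simp
    \<comment> \<open>Position \<open>r + 1\<close> is the first one beyond the window around 0, and
      \<open>2 * r + 1 < n\<close> keeps it out of the window around \<open>n\<close>.\<close>
    define j where "j = nat (r + 1)"
    have j: "j < n" "int j = r + 1" using elim(2) r0 by (auto simp: j_def)
    have "evenperm (word_map n g)"
    proof (rule evenperm_independent_bit[OF _ j(1)])
      show "word_map n g permutes words n" using elim by simp
      fix w :: "bool list" and b assume w: "length w = n"
      let ?x = "periodic_extension w" and ?y = "periodic_extension (w[j := b])"
      have x: "periodic n ?x" and y: "periodic n ?y"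
        using w by (simp_all add: periodic_periodic_extension)
      have nth: "?x (int i) = w ! i" "?y (int i) = w[j := b] ! i" if "i < n" for i
        using that w periodic_extension_nth[of i w] periodic_extension_nth[of i "w[j := b]"] by auto
      have far: "r < \<bar>int j - k * int n\<bar>" for k
      proof (cases "1 \<le> k")
        case True
        then have "1 * int n \<le> k * int n" by (intro mult_right_mono) auto
        with j elim(2) show ?thesis by linarith
      next
        case False
        then have "k * int n \<le> 0 * int n" by (intro mult_right_mono) auto
        with j show ?thesis by linarith
      qed
      \<comment> \<open>A coordinate of the window that reads bit \<open>j\<close> of the word would
        put \<open>j\<close> within \<open>r\<close> of a multiple of \<open>n\<close>, contrary to
        \<open>far\<close>.\<close>
      have agree: "?x i = ?y i" if "\<bar>i\<bar> \<le> r" for i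
      proof -
        have m: "0 \<le> i mod int n" "i mod int n < int n" using n r0 by simp_all
        have "nat (i mod int n) \<noteq> j"
        proof
          assume "nat (i mod int n) = j"
          then have "int j = i mod int n" using m(1) by linarith
          then have "int j - (- (i div int n)) * int n = i"
            using mod_div_mult_eq[of i "int n"] by linarith
          with far[of "- (i div int n)"] that show False by linarith
        qed
        then show ?thesis using w by (simp add: periodic_extension_def)
      qed
      show "word_map n g (w[j := b]) = (word_map n g w)[j := b]"
      proof (rule nth_equalityI)
        fix i assume "i < length (word_map n g (w[j := b]))"
        then have i: "i < n" using w by simp
        have "periodize n g ?y (int i) = (if i = j then b else periodize n g ?x (int i))"
        proof (cases "\<exists>k. \<bar>int i - k * int n\<bar> \<le> r")
          case True
          then obtain k where k: "\<bar>int i - k * int n\<bar> \<le> r" ..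
          then have "i \<noteq> j" using far[of k] by auto
          with local_onD(3)[OF r agree k] show ?thesis
            by (simp add: periodize_near[OF r n x k] periodize_near[OF r n y k])
        next
          case False
          then have "r < \<bar>int i - k * int n\<bar>" for k by (simp add: not_le)
          then show ?thesis
            using periodize_far[OF r] nth[OF i] i w by (simp add: nth_list_update)
        qed
        then show "word_map n g (w[j := b]) ! i = (word_map n g w)[j := b] ! i"
          using i w j(1) word_map_inert[OF g r n] by (simp add: nth_list_update)
      qed (simp add: w)
    qed
    then show ?case using elim by (simp add: word_alt_def)
  qed
qed

text \<open>Evenness holds for the rotation and for inert maps and passes to products and inverses,
  where each step discards finitely many \<open>n\<close>.\<close>

lemma word_map_even:
  assumes "f \<in> shift_inert_group"
  shows "\<forall>\<^sub>F n in sequentially. word_map n f \<in> word_alt n"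
proof -
  have gen: "\<forall>\<^sub>F n in sequentially. word_map n h \<in> word_alt n"
    if "h \<in> insert shift {f. inert f}" for h
  proof (cases "h = shift")
    case True
    show ?thesis
      using eventually_ge_at_top[of 3]
    proof eventually_elim
      case (elim n)
      then show ?case
        unfolding True using bit_perm_permutes(1)[OF rot_permutes] evenperm_bit_perm[OF rot_permutes]
        by (simp add: word_map_shift_eq word_alt_def)
    qed
  qed (use that word_map_inert_even in auto)
  show ?thesis
    using assms unfolding shift_inert_group_def
  proof (induction f rule: generate.induct)
    case one
    show ?case by (rule word_map_inert_even) (simp only: homeo_group_simps inert_id)
  next
    case (incl h)
    then show ?case by (rule gen)
  next
    case (inv h)
    then have "h \<in> shift_inert_group" by (auto intro: shift_inert_groupI)
    from gen[OF inv] word_map_permutes[OF this] show ?case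
      by eventually_elim (simp add: word_alt_inv)
  next
    case (eng h1 h2)
    have "h1 \<in> shift_inert_group" "h2 \<in> shift_inert_group"
      using eng(1,2) by (simp_all only: shift_inert_group_def)
    from eng(3,4) word_map_comp[OF this] show ?case
      unfolding homeo_group_simps by eventually_elim (simp only: word_alt_comp)
  qed
qed

text \<open>Induction along an expression of \<open>f\<close> in the generators: each product or
  inverse is respected for all large \<open>n\<close>, with a threshold that depends on
  \<open>f\<close>.\<close>

lemma word_map_in_generate:
  assumes F: "F \<subseteq> shift_inert_group" and "f \<in> generate homeo_group F"
  shows "\<forall>\<^sub>F n in sequentially. word_map n f \<in> generate (word_sym_group n) (word_map n ` F)"
  using assms(2)
proof (induction f rule: generate.induct)
  case one
  show ?case
    using eventually_gt_at_top[of 0]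
  proof eventually_elim
    case (elim n)
    show ?case
      unfolding homeo_group_simps word_map_id[OF elim]
      using generate.one[of "word_sym_group n"] by (simp only: word_sym_group_simps)
  qed
next
  case (incl h)
  then show ?case by (intro always_eventually allI generate.incl imageI)
next
  case (inv h)
  with F have "h \<in> shift_inert_group" by auto
  from word_map_permutes[OF this] show ?case
  proof eventually_elim
    case (elim n)
    then have "word_map n (inv\<^bsub>homeo_group\<^esub> h) = inv\<^bsub>word_sym_group n\<^esub> (word_map n h)"
      by (simp add: inv_word_sym_group)
    then show ?case using inv by (simp only:) (intro generate.inv imageI)
  qed
next
  case (eng h1 h2)
  have "generate homeo_group F \<subseteq> shift_inert_group"
    by (rule homeo.generate_subgroup_incl[OF F shift_inert_group_subgroup])
  with eng(1,2) have "h1 \<in> shift_inert_group" "h2 \<in> shift_inert_group" by auto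
  from word_map_comp[OF this] eng(3,4) show ?case
  proof eventually_elim
    case (elim n)
    then show ?case
      unfolding homeo_group_simps elim(1)
      using generate.eng[OF elim(2,3)] by (simp only: word_sym_group_simps)
  qed
qed

theorem theorem1:
  fixes F :: "(point \<Rightarrow> point) set"
  assumes "finite F"
    and "F \<subseteq> shift_inert_group"
    and "generate homeo_group F = shift_inert_group"
  shows "\<forall>\<^sub>F n in sequentially.
    (\<forall>f\<in>F. word_map_defined n f) \<and>
    generate (word_sym_group n) (word_map n ` F) = word_alt n"
proof -
  have in_generate: "\<forall>\<^sub>F n in sequentially. word_map n f \<in> generate (word_sym_group n) (word_map n ` F)"
    if "f \<in> shift_inert_group" for f
    using word_map_in_generate[OF assms(2)] that assms(3) by simp
  note gate = in_generate[OF shift_inert_groupI(2)]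
  \<comment> \<open>Four fixed elements of G suffice, so their separate thresholds can be combined
    into one.\<close>
  note gates = in_generate[OF shift_inert_groupI(1)] gate[OF swap_gate(1)] gate[OF not_gate(1)]
    gate[OF toffoli_gate(1)]
  \<comment> \<open>Finiteness of \<open>F\<close> turns the thresholds of its members into a single
    one, here and for evenness.\<close>
  have "\<forall>\<^sub>F n in sequentially. \<forall>f\<in>F. word_map_defined n f"
    unfolding word_map_defined_def
    using assms(1) by (intro eventually_ball_finite ballI eventually_gt_at_top) auto
  moreover have "\<forall>\<^sub>F n in sequentially. \<forall>f\<in>F. word_map n f \<in> word_alt n"
    using assms(1,2) word_map_even by (intro eventually_ball_finite ballI) auto
  ultimately show ?thesis
    using gates eventually_gt_at_top[of 4]
  proof eventually_elim
    case (elim n)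
    let ?K = "generate (word_sym_group n) (word_map n ` F)"
    have n: "4 < n" by (rule elim)
    have sub: "?K \<subseteq> word_alt n"
      using elim(2) by (intro group.generate_subgroup_incl[OF group_word_sym_group _ subgroup_word_alt]) auto
    have carrier: "word_map n ` F \<subseteq> carrier (word_sym_group n)"
      using elim(2) by (auto simp: word_sym_group_simps word_alt_def)
    interpret word_gates n ?K
    proof
      show "4 \<le> n" using n by simp
      show "id \<in> ?K" using generate.one[of "word_sym_group n"] by (simp only: word_sym_group_simps)
      show "p \<circ> q \<in> ?K" if "p \<in> ?K" "q \<in> ?K" for p q
        using generate.eng[OF that] by (simp only: word_sym_group_simps)
      \<comment> \<open>Inversion in \<open>word_sym_group n\<close> is the inverse function only
        for permutations of the words, so the inclusion \<open>sub\<close> is needed first.\<close>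
      show "inv_into UNIV p \<in> ?K" if "p \<in> ?K" for p
      proof -
        have "p permutes words n" using sub that by (auto simp: word_alt_def)
        then show ?thesis
          using group.generate_m_inv_closed[OF group_word_sym_group carrier that]
          by (simp only: inv_word_sym_group)
      qed
      show "bit_perm n (rot n) \<in> ?K" using elim(3) n by (simp only: word_map_shift_eq)
      show "bit_perm n (transpose 0 1) \<in> ?K" using elim(4) by (simp only: swap_gate(2)[OF n])
      show "cnot n {} (\<lambda>_. True) 0 \<in> ?K" using elim(5) by (simp only: not_gate(2)[OF n])
      show "cnot n {0, 1} (\<lambda>_. True) 2 \<in> ?K" using elim(6) by (simp only: toffoli_gate(2)[OF n])
    qed
    have "word_alt n \<subseteq> ?K" using even_permutation_in by (auto simp: word_alt_def)
    with sub elim(1) show ?case by auto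
  qed
qed

end
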